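(* Let $N\ge 1$, $R>0$, $m>1$ with $N>m$, $p>1$, $\alpha,\beta\in\mathbb R$ and $\gamma\in(0,m-1)$. Assume: (H0) $N+\alpha-m>0$ and $\beta-\alpha+1>0$; (H1) $m-1<p<m^*_{\alpha,\beta,\gamma}-1$ and $0<\gamma<\Upsilon$, where $$m^*_{\alpha,\beta,\gamma}=\frac{m(m-1)(N+\beta)-\gamma[m(N+\beta+1)-N-\alpha]}{(m-1)(N+\alpha-m)},\qquad \Upsilon=\frac{m(m-1)(\beta-\alpha+m)}{m(N+\beta+1)-N-\alpha};$$ (H2) $g:[0,\infty)\to[0,\infty)$ is continuous, nondecreasing and $\lim_{v\to\infty}g(v)/v=1$; (H3) $a:[0,\infty)\to(0,\infty)$ is continuous and there are constants $0<c_1\le c_2$ with $c_1\le a(t)\le c_2$ for all $t\ge0$. Then the problem $$-\mathrm{div}\Big(\frac{|x|^\alpha|\nabla u|^{m-2}\nabla u}{(a(|x|)+g(u))^\gamma}\Big)=|x|^\beta u^p \ \text{in } B_R\setminus\{0\},\qquad u=0 \text{ on }\partial B_R$$ has at least one positive radial solution.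
   Context: $B_R$ is the open ball of radius $R$ centered at the origin in $\mathbb R^N$. A positive radial solution is a function $u(x)=v(|x|)$ with $v>0$ on $[0,R)$ such that $v\in C^1[0,R)\cap C[0,R]$, the function $r\mapsto r^{N+\alpha-1}|v'(r)|^{m-2}v'(r)\,[a(r)+g(v(r))]^{-\gamma}$ belongs to $C^1(0,R)$, and $v$ satisfies $$-\Big(\frac{r^{N+\alpha-1}|v'(r)|^{m-2}v'(r)}{(a(r)+g(v(r)))^\gamma}\Big)'=r^{N+\beta-1}v^p(r),\ 0<r<R,\qquad v'(0)=0,\ v(R)=0.$$ *)

theory Defs
  imports "HOL-Analysis.Analysis"
begin

definition flux :: "nat \<Rightarrow> real \<Rightarrow> real \<Rightarrow> real \<Rightarrow> (real \<Rightarrow> real) \<Rightarrow> (real \<Rightarrow> real)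
    \<Rightarrow> (real \<Rightarrow> real) \<Rightarrow> (real \<Rightarrow> real) \<Rightarrow> real \<Rightarrow> real" where
  "flux N m alpha gamma a g v dv r =
     r powr (real N + alpha - 1) * (\<bar>dv r\<bar> powr (m - 2) * dv r) / (a r + g (v r)) powr gamma"

definition positive_radial_solution ::
  "nat \<Rightarrow> real \<Rightarrow> real \<Rightarrow> real \<Rightarrow> real \<Rightarrow> real \<Rightarrow> real \<Rightarrow> (real \<Rightarrow> real) \<Rightarrow> (real \<Rightarrow> real)
    \<Rightarrow> (real \<Rightarrow> real) \<Rightarrow> bool" where
  "positive_radial_solution N R m alpha beta gamma p a g v \<longleftrightarrow>
     (\<forall>r\<in>{0..<R}. v r > 0) \<and>
     continuous_on {0..R} v \<and>
     (\<exists>dv. (\<forall>r\<in>{0..<R}. (v has_real_derivative dv r) (at r within {0..<R})) \<and>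
           continuous_on {0..<R} dv \<and>
           dv 0 = 0 \<and>
           (\<exists>dw. (\<forall>r\<in>{0<..<R}.
                    (flux N m alpha gamma a g v dv has_real_derivative dw r) (at r)) \<and>
                 continuous_on {0<..<R} dw \<and>
                 (\<forall>r\<in>{0<..<R}. - dw r = r powr (real N + beta - 1) * v r powr p))) \<and>
     v R = 0"

end

theory Submission
  imports Defs "HOL-Complex_Analysis.Great_Picard"
begin

text \<open>
  With \<open>\<theta> = N + \<alpha> - 1\<close> and \<open>\<sigma> = N + \<beta> - 1\<close> a radial solution is a solution of the integral equation
  \<open>v(t) = d - \<integral>\<^sub>0\<^sup>t ((a(s) + g(v))\<^sup>\<gamma> s\<^sup>-\<^sup>\<theta> \<integral>\<^sub>0\<^sup>s \<tau>\<^sup>\<sigma> v\<^sup>p d\<tau>)\<^bsup>1/(m-1)\<^esup> ds\<close> with \<open>v(R) = 0\<close>. It is found by shooting in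
  the initial value \<open>d\<close>. Since \<open>a\<close> and \<open>g\<close> are only continuous, solutions need not be unique, so one
  shoots with a delayed equation (Tonelli's scheme), whose solutions are explicit and depend
  continuously on \<open>d\<close>, and removes the delay by compactness. Small \<open>d\<close> gives \<open>v(R) > 0\<close> because \<open>p > m - 1\<close>.
  If \<open>v(R) \<ge> 0\<close> held for arbitrarily large \<open>d\<close>, rescaling would produce, on arbitrarily long intervals,
  a positive solution of the equation with coefficient \<open>v\<^sup>\<gamma>\<close>. The substitution \<open>u = v\<^sup>\<delta>\<close>,
  \<open>\<delta> = 1 - \<gamma>/(m-1)\<close>, turns it into a weighted Emden--Fowler equation for the \<open>m\<close>-Laplacian with exponent
  \<open>q = p/\<delta>\<close>, for which the bound on \<open>p\<close> is exactly subcriticality. There a Pohozaev functional is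
  increasing and positive, but the decay of positive solutions forces it to tend to zero.
\<close>

section \<open>The integral operator\<close>

text \<open>For negative \<sigma> the weight is unbounded at 0. It is still absolutely integrable
  because \<open>\<sigma> > -1\<close>, and \<open>f\<close> is a bounded measurable factor.\<close>

lemma integrable_powr_mult:
  fixes f :: "real \<Rightarrow> real"
  assumes "\<sigma> > -1" "0 \<le> s" "continuous_on {0..s} f"
  shows "(\<lambda>\<tau>. \<tau> powr \<sigma> * f \<tau>) integrable_on {0..s}"
proof -
  have "(\<lambda>\<tau>. \<tau> powr \<sigma>) absolutely_integrable_on {0..s}"
    by (intro nonnegative_absolutely_integrable_1 integrable_on_powr_from_0) (use assms in auto)
  moreover have "f \<in> borel_measurable (lebesgue_on {0..s})"
    by (rule continuous_imp_measurable_on_sets_lebesgue) (use assms in auto)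
  moreover have "bounded (f ` {0..s})"
    using assms by (intro compact_imp_bounded compact_continuous_image) auto
  ultimately have "(\<lambda>\<tau>. f \<tau> * \<tau> powr \<sigma>) absolutely_integrable_on {0..s}"
    by (intro absolutely_integrable_bounded_measurable_product_real) auto
  then show ?thesis
    by (simp add: set_lebesgue_integral_eq_integral(1) mult.commute)
qed

text \<open>For the exponents \<theta> and \<sigma> of the two weights, \<open>theta_gt\<close> and
  \<open>sigma_gt\<close> are the two inequalities of (H0). Positivity of
  \<open>\<sigma> + 1 - \<theta>\<close> makes the slope of a solution vanish at the centre.\<close>

locale radial =
  fixes m \<theta> \<sigma> p :: real
  assumes m_gt_1: "m > 1" and theta_gt: "\<theta> > m - 1" and sigma_gt: "\<sigma> > \<theta> - 1" and p_pos: "p > 0"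
begin

text \<open>For a solution this is minus the flux at radius \<open>s\<close>. The positive part lets
  the equation continue past a zero of \<open>x\<close>, so that shooting can produce negative
  values at \<open>R\<close>.\<close>

definition mass :: "(real \<Rightarrow> real) \<Rightarrow> real \<Rightarrow> real" where
  "mass x s = integral {0..s} (\<lambda>\<tau>. \<tau> powr \<sigma> * max 0 (x \<tau>) powr p)"

text \<open>The value of \<open>- x'\<close> found by solving the flux identity for the derivative;
  \<open>A\<close> stands for \<open>(a + g) powr \<gamma>\<close>.\<close>

definition slope :: "(real \<Rightarrow> real \<Rightarrow> real) \<Rightarrow> (real \<Rightarrow> real) \<Rightarrow> real \<Rightarrow> real" where
  "slope A x s = (A s (x s) * (s powr - \<theta> * mass x s)) powr (1 / (m - 1))"

lemma sigma_gt_m1: "\<sigma> > -1"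
  using m_gt_1 theta_gt sigma_gt by linarith

lemma continuous_on_pos_powr:
  "continuous_on S x \<Longrightarrow> continuous_on S (\<lambda>\<tau>. max 0 (x \<tau>) powr p)" for x :: "real \<Rightarrow> real"
  by (intro continuous_on_powr' continuous_intros) (use p_pos in auto)

lemma mass_integrable:
  assumes "continuous_on {0..T} x" "0 \<le> s" "s \<le> T"
  shows "(\<lambda>\<tau>. \<tau> powr \<sigma> * max 0 (x \<tau>) powr p) integrable_on {0..s}"
  by (intro integrable_powr_mult sigma_gt_m1 assms(2) continuous_on_pos_powr)
     (use assms continuous_on_subset in fastforce)

lemma powr_has_integral:
  assumes "0 \<le> s"
  shows "((\<lambda>\<tau>. \<tau> powr \<sigma> * c) has_integral (s powr (\<sigma> + 1) / (\<sigma> + 1) * c)) {0..s}"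
  using has_integral_powr_from_0[of \<sigma> s, THEN has_integral_mult_left[of _ _ _ c]] sigma_gt_m1 assms by simp

lemma mass_nonneg: "0 \<le> s \<Longrightarrow> 0 \<le> mass x s"
  unfolding mass_def by (cases "(\<lambda>\<tau>. \<tau> powr \<sigma> * max 0 (x \<tau>) powr p) integrable_on {0..s}")
    (auto intro!: integral_nonneg simp: not_integrable_integral)

lemma mass_0 [simp]: "mass x 0 = 0"
  by (simp add: mass_def)

lemma mass_le:
  assumes "continuous_on {0..T} x" "0 \<le> s" "s \<le> T" "\<And>\<tau>. \<tau> \<in> {0..s} \<Longrightarrow> max 0 (x \<tau>) \<le> M"
  shows "mass x s \<le> s powr (\<sigma> + 1) / (\<sigma> + 1) * M powr p"
  unfolding mass_def
proof (rule has_integral_le[OF integrable_integral powr_has_integral])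
  show "(\<lambda>\<tau>. \<tau> powr \<sigma> * max 0 (x \<tau>) powr p) integrable_on {0..s}"
    by (rule mass_integrable) (use assms in auto)
  fix \<tau> assume "\<tau> \<in> {0..s}"
  then show "\<tau> powr \<sigma> * max 0 (x \<tau>) powr p \<le> \<tau> powr \<sigma> * M powr p"
    using p_pos assms by (intro mult_left_mono powr_mono2) auto
qed fact

lemma mass_ge:
  assumes "continuous_on {0..T} x" "0 \<le> s" "s \<le> T" "\<And>\<tau>. \<tau> \<in> {0..s} \<Longrightarrow> c \<le> x \<tau>" "0 \<le> c"
  shows "s powr (\<sigma> + 1) / (\<sigma> + 1) * c powr p \<le> mass x s"
  unfolding mass_def
proof (rule has_integral_le[OF powr_has_integral integrable_integral])
  show "(\<lambda>\<tau>. \<tau> powr \<sigma> * max 0 (x \<tau>) powr p) integrable_on {0..s}"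
    by (rule mass_integrable) (use assms in auto)
  fix \<tau> assume "\<tau> \<in> {0..s}"
  then show "\<tau> powr \<sigma> * c powr p \<le> \<tau> powr \<sigma> * max 0 (x \<tau>) powr p"
    using p_pos assms by (intro mult_left_mono powr_mono2) (auto simp: max_def intro: order_trans)
qed fact

lemma mass_split:
  assumes "continuous_on {0..T} x" "0 \<le> r" "r \<le> s" "s \<le> T"
  shows "mass x s = mass x r + integral {r..s} (\<lambda>\<tau>. \<tau> powr \<sigma> * max 0 (x \<tau>) powr p)"
  unfolding mass_def
  by (rule Henstock_Kurzweil_Integration.integral_combine[symmetric])
     (use assms mass_integrable in auto)

lemma mass_mono:
  assumes "continuous_on {0..T} x" "0 \<le> r" "r \<le> s" "s \<le> T"
  shows "mass x r \<le> mass x s"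
proof -
  have "0 \<le> integral {r..s} (\<lambda>\<tau>. \<tau> powr \<sigma> * max 0 (x \<tau>) powr p)"
    by (intro integral_nonneg integrable_on_subinterval[OF mass_integrable[OF assms(1), of s]])
       (use assms in auto)
  then show ?thesis using mass_split[OF assms] by simp
qed

text \<open>The integrand may be singular at 0, so the fundamental theorem of calculus is applied on
  \<open>{s/2..T}\<close>.\<close>

lemma mass_has_derivative:
  assumes "continuous_on {0..T} x" "0 < s" "s < T"
  shows "(mass x has_real_derivative s powr \<sigma> * max 0 (x s) powr p) (at s)"
proof -
  let ?f = "\<lambda>\<tau>. \<tau> powr \<sigma> * max 0 (x \<tau>) powr p"
  have "continuous_on {s/2..T} ?f"
    by (intro continuous_intros continuous_on_pos_powr)
       (use assms in \<open>auto intro: continuous_on_subset\<close>)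
  from integral_has_real_derivative[OF this, of s]
  have "((\<lambda>r. integral {s/2..r} ?f) has_real_derivative ?f s) (at s within {s/2..T})"
    using assms by auto
  then have "((\<lambda>r. integral {s/2..r} ?f) has_real_derivative ?f s) (at s)"
    using at_within_Icc_at[of "s/2" s T] assms by simp
  then have "((\<lambda>r. mass x (s/2) + integral {s/2..r} ?f) has_real_derivative ?f s) (at s)"
    by (auto intro!: derivative_eq_intros)
  moreover have "\<forall>\<^sub>F r in nhds s. mass x (s/2) + integral {s/2..r} ?f = mass x r"
    using eventually_nhds_in_open[of "{s/2<..<T}" s] assms
    by (auto elim!: eventually_mono intro!: mass_split[symmetric])
  ultimately show ?thesis
    by (subst (asm) DERIV_cong_ev[OF refl _ refl]) auto
qed

lemma continuous_on_mass:
  assumes "continuous_on {0..T} x"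
  shows "continuous_on {0..T} (mass x)"
proof (cases "T \<ge> 0")
  case True
  show ?thesis unfolding mass_def
    by (rule indefinite_integral_continuous_1[OF mass_integrable[OF assms]]) (use True in auto)
qed auto

lemma ratio_bound:
  assumes "continuous_on {0..T} x" "0 \<le> s" "s \<le> T" "\<And>\<tau>. \<tau> \<in> {0..s} \<Longrightarrow> max 0 (x \<tau>) \<le> M"
  shows "s powr - \<theta> * mass x s \<le> s powr (\<sigma> + 1 - \<theta>) / (\<sigma> + 1) * M powr p"
proof -
  have "s powr - \<theta> * mass x s \<le> s powr - \<theta> * (s powr (\<sigma> + 1) / (\<sigma> + 1) * M powr p)"
    by (intro mult_left_mono mass_le[OF assms]) auto
  also have "\<dots> = s powr (-\<theta> + (\<sigma> + 1)) / (\<sigma> + 1) * M powr p"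
    by (simp only: powr_add mult.assoc) simp
  finally show ?thesis by (simp add: algebra_simps)
qed

text \<open>Only \<open>s = 0\<close> is delicate: the blow-up of \<open>s powr - \<theta>\<close>
  is beaten by the mass, which is at most of order \<open>s powr (\<sigma> + 1)\<close>. The value
  at 0 is 0 and agrees with the limit.\<close>

lemma continuous_on_ratio:
  assumes "continuous_on {0..T} x" "0 \<le> T"
  shows "continuous_on {0..T} (\<lambda>s. s powr - \<theta> * mass x s)"
proof -
  obtain M where M: "\<And>\<tau>. \<tau> \<in> {0..T} \<Longrightarrow> norm (x \<tau>) \<le> M" "0 < M"
  proof -
    have "bounded (x ` {0..T})"
      using assms by (intro compact_imp_bounded compact_continuous_image) auto
    then show thesis using that unfolding bounded_pos by blast
  qed
  have "((\<lambda>s. s powr - \<theta> * mass x s) \<longlongrightarrow> s powr - \<theta> * mass x s) (at s within {0..T})"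
    if s: "s \<in> {0..T}" for s
  proof (cases "s = 0")
    case True
    have "((\<lambda>s. s powr - \<theta> * mass x s) \<longlongrightarrow> 0) (at 0 within {0..T})"
    proof (rule tendsto_sandwich[of "\<lambda>_. 0"])
      show "\<forall>\<^sub>F s in at 0 within {0..T}. s powr - \<theta> * mass x s \<le> s powr (\<sigma> + 1 - \<theta>) / (\<sigma> + 1) * M powr p"
      proof -
        have "s powr - \<theta> * mass x s \<le> s powr (\<sigma> + 1 - \<theta>) / (\<sigma> + 1) * M powr p"
          if "s \<in> {0..T}" for s
          by (rule ratio_bound[OF assms(1)]) (use M that in \<open>auto simp: abs_le_iff\<close>)
        then show ?thesis by (auto simp: eventually_at_filter intro!: always_eventually)
      qed
      show "\<forall>\<^sub>F s in at 0 within {0..T}. 0 \<le> s powr - \<theta> * mass x s"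
        by (auto simp: eventually_at_filter intro!: always_eventually mult_nonneg_nonneg mass_nonneg)
      have "((\<lambda>s. s powr (\<sigma> + 1 - \<theta>) / (\<sigma> + 1) * M powr p) \<longlongrightarrow> 0 powr (\<sigma> + 1 - \<theta>) / (\<sigma> + 1) * M powr p) (at 0 within {0..T})"
        by (intro tendsto_intros disjI2) (use sigma_gt sigma_gt_m1 in \<open>auto simp: eventually_at_filter\<close>)
      then show "((\<lambda>s. s powr (\<sigma> + 1 - \<theta>) / (\<sigma> + 1) * M powr p) \<longlongrightarrow> 0) (at 0 within {0..T})"
        by simp
    qed auto
    then show ?thesis using True by simp
  next
    case False
    then show ?thesis
      using continuous_on_mass[OF assms(1)] s
      by (intro tendsto_intros) (auto simp: continuous_on_def)
  qed
  then show ?thesis by (simp add: continuous_on_def)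
qed

lemma slope_nonneg: "0 \<le> slope A x s"
  by (simp add: slope_def)

lemma slope_0 [simp]: "slope A x 0 = 0"
  by (simp add: slope_def)

lemma continuous_on_slope:
  assumes "continuous_on {0..T} x" "0 \<le> T" "continuous_on {0..T} (\<lambda>s. A s (x s))" "\<And>s y. 0 \<le> A s y"
  shows "continuous_on {0..T} (slope A x)"
  unfolding slope_def
  by (intro continuous_on_powr' continuous_on_mult[OF assms(3)] continuous_on_ratio assms(1,2) continuous_on_const)
     (use assms(4) m_gt_1 mass_nonneg in auto)

lemma slope_bound:
  assumes "continuous_on {0..T} x" "0 \<le> s" "s \<le> T" "\<And>\<tau>. \<tau> \<in> {0..s} \<Longrightarrow> x \<tau> \<le> M" "0 \<le> M"
    "0 \<le> A s (x s)" "A s (x s) \<le> B"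
  shows "slope A x s \<le> (B * (s powr (\<sigma> + 1 - \<theta>) / (\<sigma> + 1) * M powr p)) powr (1 / (m - 1))"
  unfolding slope_def
  by (intro powr_mono2 mult_mono ratio_bound[OF assms(1-3)])
     (use assms mass_nonneg m_gt_1 in \<open>auto intro: order_trans\<close>)

end

section \<open>Delayed equations and compactness\<close>

context radial begin

text \<open>Dominated convergence. A common upper bound on the functions suffices because only their
  positive parts enter.\<close>

lemma mass_tendsto:
  assumes "\<And>k. continuous_on {0..T} (x k)" "\<And>k s. s \<in> {0..T} \<Longrightarrow> x k s \<le> M"
    "\<And>s. s \<in> {0..T} \<Longrightarrow> (\<lambda>k. x k s) \<longlonglongrightarrow> y s" "s \<in> {0..T}"
  shows "(\<lambda>k. mass (x k) s) \<longlonglongrightarrow> mass y s"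
  unfolding mass_def
proof (rule dominated_convergence(2))
  show "(\<lambda>\<tau>. \<tau> powr \<sigma> * max 0 (x k \<tau>) powr p) integrable_on {0..s}" for k
    by (rule mass_integrable) (use assms in auto)
  show "(\<lambda>\<tau>. \<tau> powr \<sigma> * max 0 M powr p) integrable_on {0..s}"
    using assms(4) by (intro has_integral_integrable[OF powr_has_integral]) auto
  show "norm (\<tau> powr \<sigma> * max 0 (x k \<tau>) powr p) \<le> \<tau> powr \<sigma> * max 0 M powr p"
    if "\<tau> \<in> {0..s}" for k \<tau>
  proof -
    have "max 0 (x k \<tau>) powr p \<le> max 0 M powr p"
      using assms(2)[of \<tau> k] assms(4) that p_pos by (intro powr_mono2) auto
    then show ?thesis by (simp add: abs_mult mult_left_mono)
  qed
  show "(\<lambda>k. \<tau> powr \<sigma> * max 0 (x k \<tau>) powr p) \<longlonglongrightarrow> \<tau> powr \<sigma> * max 0 (y \<tau>) powr p"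
    if "\<tau> \<in> {0..s}" for \<tau>
    by (intro tendsto_intros assms(3)) (use assms(4) that p_pos in auto)
qed

lemma slope_tendsto:
  assumes "\<And>k. continuous_on {0..T} (x k)" "\<And>k s. s \<in> {0..T} \<Longrightarrow> x k s \<le> M"
    "\<And>s. s \<in> {0..T} \<Longrightarrow> (\<lambda>k. x k s) \<longlonglongrightarrow> y s" "s \<in> {0..T}"
    "\<And>s. s \<in> {0..T} \<Longrightarrow> (\<lambda>k. A k s (x k s)) \<longlonglongrightarrow> A' s (y s)" "\<And>k s z. 0 \<le> A k s z"
  shows "(\<lambda>k. slope (A k) (x k) s) \<longlonglongrightarrow> slope A' y s"
  unfolding slope_def
  by (intro tendsto_powr'[OF tendsto_mult[OF assms(5) tendsto_mult[OF tendsto_const mass_tendsto[OF assms(1-3)]]]]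
      tendsto_const disjI2)
     (use assms m_gt_1 mass_nonneg in auto)

definition admissible :: "real \<Rightarrow> (real \<Rightarrow> real \<Rightarrow> real) \<Rightarrow> bool" where
  "admissible T A \<longleftrightarrow> (\<forall>s y. 0 \<le> A s y) \<and> continuous_on ({0..T} \<times> UNIV) (\<lambda>(s, y). A s y)"

lemma admissible_compose:
  assumes "admissible T A" "continuous_on {0..T} x"
  shows "continuous_on {0..T} (\<lambda>s. A s (x s))"
proof -
  have "continuous_on {0..T} (\<lambda>s. (s, x s))"
    by (intro continuous_on_Pair continuous_on_id assms(2))
  then have "continuous_on {0..T} (\<lambda>s. case (s, x s) of (s, y) \<Rightarrow> A s y)"
    by (rule continuous_on_compose2[of "{0..T} \<times> UNIV" "\<lambda>(s, y). A s y", rotated])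
       (use assms(1) in \<open>auto simp: admissible_def\<close>)
  then show ?thesis by simp
qed

lemma admissible_tendsto:
  assumes "admissible T A" "s \<in> {0..T}" "x \<longlonglongrightarrow> y"
  shows "(\<lambda>k. A s (x k)) \<longlonglongrightarrow> A s y"
proof -
  have "continuous_on UNIV (Pair s :: real \<Rightarrow> _)"
    by (intro continuous_on_Pair continuous_on_id continuous_on_const)
  then have "continuous_on UNIV (\<lambda>y. case (s, y) of (s, y) \<Rightarrow> A s y)"
    by (rule continuous_on_compose2[of "{0..T} \<times> UNIV" "\<lambda>(s, y). A s y", rotated])
       (use assms(1,2) in \<open>auto simp: admissible_def\<close>)
  then have "continuous_on UNIV (A s)" by simp
  then show ?thesis using assms(3) continuous_on_tendsto_compose by fastforce
qed

lemma admissible_slope: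
  assumes "admissible T A" "continuous_on {0..T} x" "0 \<le> T"
  shows "continuous_on {0..T} (slope A x)"
  using assms continuous_on_slope[of T x A] admissible_compose[OF assms(1,2)]
  by (auto simp: admissible_def)

text \<open>Bounds the speed of any function below \<open>M\<close> on \<open>{0..T}\<close> when
  the coefficient is at most \<open>B\<close>. It serves both as dominating constant and as
  Lipschitz constant.\<close>

definition slope_cap :: "real \<Rightarrow> real \<Rightarrow> real \<Rightarrow> real" where
  "slope_cap T M B = (B * (T powr (\<sigma> + 1 - \<theta>) / (\<sigma> + 1) * M powr p)) powr (1 / (m - 1))"

lemma slope_le_cap:
  assumes "continuous_on {0..T} x" "0 \<le> s" "s \<le> T" "\<And>\<tau>. \<tau> \<in> {0..s} \<Longrightarrow> x \<tau> \<le> M" "0 \<le> M"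
    "0 \<le> A s (x s)" "A s (x s) \<le> B"
  shows "slope A x s \<le> slope_cap T M B"
proof -
  have "slope A x s \<le> (B * (s powr (\<sigma> + 1 - \<theta>) / (\<sigma> + 1) * M powr p)) powr (1 / (m - 1))"
    by (rule slope_bound) (use assms in auto)
  also have "\<dots> \<le> slope_cap T M B" unfolding slope_cap_def
    by (intro powr_mono2 mult_mono divide_right_mono) (use assms sigma_gt sigma_gt_m1 m_gt_1 p_pos in auto)
  finally show ?thesis .
qed

text \<open>The coefficient varies with \<open>k\<close> because in the blow-up argument it is
  rescaled along with the solution.\<close>

lemma slope_integral_tendsto:
  assumes "\<And>k. continuous_on {0..T} (x k)" "\<And>k s. s \<in> {0..T} \<Longrightarrow> x k s \<le> M" "0 \<le> M"
    "\<And>s. s \<in> {0..T} \<Longrightarrow> (\<lambda>k. x k s) \<longlonglongrightarrow> y s" "t \<in> {0..T}"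
    "\<And>s. s \<in> {0..T} \<Longrightarrow> (\<lambda>k. A k s (x k s)) \<longlonglongrightarrow> A' s (y s)" "\<And>k. admissible T (A k)"
    "\<And>k s z. s \<in> {0..T} \<Longrightarrow> z \<le> M \<Longrightarrow> A k s z \<le> B"
  shows "(\<lambda>k. integral {0..t} (slope (A k) (x k))) \<longlonglongrightarrow> integral {0..t} (slope A' y)"
proof (rule dominated_convergence(2))
  have nn: "0 \<le> A k s z" for k s z using assms(7) by (auto simp: admissible_def)
  show "slope (A k) (x k) integrable_on {0..t}" for k
    using continuous_on_subset[OF admissible_slope[OF assms(7,1)], of "{0..t}"] assms(5)
    by (auto intro!: integrable_continuous_real)
  show "(\<lambda>_. slope_cap T M B) integrable_on {0..t}" by auto
  show "norm (slope (A k) (x k) s) \<le> slope_cap T M B" if "s \<in> {0..t}" for k s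
    using slope_le_cap[of T "x k" s M "A k" B] that assms nn slope_nonneg[of "A k" "x k" s] by auto
  show "(\<lambda>k. slope (A k) (x k) s) \<longlonglongrightarrow> slope A' y s" if "s \<in> {0..t}" for s
    by (rule slope_tendsto[where M = M and T = T]) (use assms that nn in auto)
qed

text \<open>Cutting the argument off at 0 extends \<open>v\<close> to the left by its initial value,
  which supplies the history of the delayed equation.\<close>

definition shift :: "real \<Rightarrow> (real \<Rightarrow> real) \<Rightarrow> real \<Rightarrow> real" where
  "shift \<epsilon> v s = v (max 0 (s - \<epsilon>))"

lemma continuous_on_shift:
  assumes "continuous_on {0..T} v" "0 \<le> \<epsilon>" shows "continuous_on {0..T} (shift \<epsilon> v)"
  unfolding shift_def
  by (rule continuous_on_compose2[OF assms(1)]) (use assms(2) in \<open>auto intro!: continuous_intros\<close>)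

definition picard :: "(real \<Rightarrow> real \<Rightarrow> real) \<Rightarrow> real \<Rightarrow> real \<Rightarrow> (real \<Rightarrow> real) \<Rightarrow> real \<Rightarrow> real" where
  "picard A \<epsilon> d v t = d - integral {0..t} (slope A (shift \<epsilon> v))"

text \<open>The case \<open>\<epsilon> = 0\<close> is the original integral equation, so one
  compactness argument covers delayed and undelayed solutions.\<close>

definition delayed_solution where
  "delayed_solution A \<epsilon> d T v \<longleftrightarrow> continuous_on {0..T} v \<and> (\<forall>t\<in>{0..T}. v t = picard A \<epsilon> d v t)"

lemma picard_le:
  "0 \<le> t \<Longrightarrow> picard A \<epsilon> d v t \<le> d"
  unfolding picard_def by (cases "slope A (shift \<epsilon> v) integrable_on {0..t}")
    (auto intro!: integral_nonneg slope_nonneg simp: not_integrable_integral)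

lemma picard_has_derivative:
  assumes "admissible T A" "continuous_on {0..T} v" "0 \<le> \<epsilon>" "t \<in> {0..T}"
  shows "(picard A \<epsilon> d v has_real_derivative - slope A (shift \<epsilon> v) t) (at t within {0..T})"
proof -
  have "continuous_on {0..T} (slope A (shift \<epsilon> v))"
    using assms by (intro admissible_slope continuous_on_shift) auto
  from integral_has_real_derivative[OF this assms(4)] show ?thesis
    unfolding picard_def by (auto intro!: derivative_eq_intros)
qed

lemma continuous_on_picard:
  assumes "admissible T A" "continuous_on {0..T} v" "0 \<le> \<epsilon>"
  shows "continuous_on {0..T} (picard A \<epsilon> d v)"
  using picard_has_derivative[OF assms] by (meson DERIV_continuous continuous_on_eq_continuous_within)

text \<open>For a positive delay the iteration becomes stationary: each step determines the
  solution on a further interval of length \<open>\<epsilon>\<close>.\<close>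

definition iterate :: "(real \<Rightarrow> real \<Rightarrow> real) \<Rightarrow> real \<Rightarrow> nat \<Rightarrow> real \<Rightarrow> real \<Rightarrow> real" where
  "iterate A \<epsilon> n d = (picard A \<epsilon> d ^^ n) (\<lambda>_. d)"

lemma iterate_0 [simp]: "iterate A \<epsilon> 0 d = (\<lambda>_. d)"
  and iterate_Suc [simp]: "iterate A \<epsilon> (Suc n) d = picard A \<epsilon> d (iterate A \<epsilon> n d)"
  by (simp_all add: iterate_def)

lemma continuous_on_iterate:
  assumes "admissible T A" "0 \<le> \<epsilon>"
  shows "continuous_on {0..T} (iterate A \<epsilon> n d)"
  by (induction n) (use assms in \<open>auto intro!: continuous_on_picard\<close>)

lemma iterate_le: "0 \<le> t \<Longrightarrow> iterate A \<epsilon> n d t \<le> d"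
  by (cases n) (auto simp: picard_le)

lemma slope_cong:
  assumes "\<And>\<tau>. \<tau> \<in> {0..s} \<Longrightarrow> x \<tau> = y \<tau>" "0 \<le> s"
  shows "slope A x s = slope A y s"
proof -
  have "mass x s = mass y s"
    unfolding mass_def by (intro Henstock_Kurzweil_Integration.integral_cong) (simp add: assms)
  then show ?thesis using assms by (simp add: slope_def)
qed

lemma iterate_stationary:
  assumes "0 < \<epsilon>" "0 \<le> t" "t \<le> real n * \<epsilon>"
  shows "iterate A \<epsilon> (Suc n) d t = iterate A \<epsilon> n d t"
  using assms(2,3)
proof (induction n arbitrary: t)
  case 0
  then show ?case by (simp add: picard_def)
next
  case (Suc n)
  \<comment> \<open>The delay moves \<open>{0..t}\<close> into \<open>{0..n * \<epsilon>}\<close>,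
    where the induction hypothesis identifies the two iterates.\<close>
  have "slope A (shift \<epsilon> (iterate A \<epsilon> (Suc n) d)) s = slope A (shift \<epsilon> (iterate A \<epsilon> n d)) s"
    if "s \<in> {0..t}" for s
    by (rule slope_cong) (use that Suc.prems assms(1) in \<open>auto simp: shift_def algebra_simps
        simp del: iterate_Suc intro!: Suc.IH\<close>)
  then have "integral {0..t} (slope A (shift \<epsilon> (iterate A \<epsilon> (Suc n) d))) =
      integral {0..t} (slope A (shift \<epsilon> (iterate A \<epsilon> n d)))"
    by (rule Henstock_Kurzweil_Integration.integral_cong)
  then show ?case
    unfolding iterate_Suc[of A \<epsilon> "Suc n"] iterate_Suc[of A \<epsilon> n] picard_def[of A \<epsilon> d _ t] by simp
qed

lemma iterate_solution:
  assumes "admissible T A" "0 < \<epsilon>" "T \<le> real n * \<epsilon>"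
  shows "delayed_solution A \<epsilon> d T (iterate A \<epsilon> n d)"
  unfolding delayed_solution_def
proof (intro conjI ballI)
  show "continuous_on {0..T} (iterate A \<epsilon> n d)" using continuous_on_iterate assms by simp
  show "iterate A \<epsilon> n d t = picard A \<epsilon> d (iterate A \<epsilon> n d) t" if "t \<in> {0..T}" for t
    using iterate_stationary[of \<epsilon> t n A d] that assms by auto
qed

text \<open>Continuous dependence on the initial value, by induction over finitely many iteration
  steps. For the undelayed equation it could fail for lack of uniqueness.\<close>

lemma iterate_tendsto:
  assumes "admissible T A" "0 \<le> \<epsilon>" "d \<longlonglongrightarrow> d'" "\<And>k. d k \<le> M" "0 \<le> M" "t \<in> {0..T}"
    "\<And>s z. s \<in> {0..T} \<Longrightarrow> z \<le> M \<Longrightarrow> A s z \<le> B"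
  shows "(\<lambda>k. iterate A \<epsilon> n (d k) t) \<longlonglongrightarrow> iterate A \<epsilon> n d' t"
  using assms(6)
proof (induction n arbitrary: t)
  case 0
  then show ?case using assms by simp
next
  case (Suc n)
  let ?x = "\<lambda>k. shift \<epsilon> (iterate A \<epsilon> n (d k))"
  have conv: "(\<lambda>k. ?x k s) \<longlonglongrightarrow> shift \<epsilon> (iterate A \<epsilon> n d') s" if "s \<in> {0..T}" for s
    unfolding shift_def by (rule Suc.IH) (use that assms(2) in auto)
  have "(\<lambda>k. integral {0..t} (slope A (?x k))) \<longlonglongrightarrow> integral {0..t} (slope A (shift \<epsilon> (iterate A \<epsilon> n d')))"
  proof (rule slope_integral_tendsto[where M = M and B = B])
    show "?x k s \<le> M" for k s
      unfolding shift_def using iterate_le[of "max 0 (s - \<epsilon>)" A \<epsilon> n "d k"] assms(4)[of k] by simp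
    show "(\<lambda>k. A s (?x k s)) \<longlonglongrightarrow> A s (shift \<epsilon> (iterate A \<epsilon> n d') s)" if "s \<in> {0..T}" for s
      using admissible_tendsto[OF assms(1) that conv[OF that]] .
  qed (use assms Suc.prems conv in \<open>auto intro!: continuous_on_shift continuous_on_iterate\<close>)
  then show ?case
    by (simp add: picard_def) (intro tendsto_intros assms)
qed

section \<open>Uniform Lipschitz bounds and compactness\<close>

lemma delayed_solution_lipschitz:
  assumes "admissible T A" "delayed_solution A \<epsilon> d T v" "0 \<le> \<epsilon>" "d \<le> M" "0 \<le> M"
    "\<And>s z. s \<in> {0..T} \<Longrightarrow> z \<le> M \<Longrightarrow> A s z \<le> B" "s \<in> {0..T}" "t \<in> {0..T}"
  shows "\<bar>v s - v t\<bar> \<le> slope_cap T M B * \<bar>s - t\<bar>"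
proof -
  have cont: "continuous_on {0..T} v" and eq: "\<And>t. t \<in> {0..T} \<Longrightarrow> v t = picard A \<epsilon> d v t"
    using assms(2) by (auto simp: delayed_solution_def)
  have le: "shift \<epsilon> v \<tau> \<le> M" if "\<tau> \<in> {0..T}" for \<tau>
    using eq[of "max 0 (\<tau> - \<epsilon>)"] picard_le[of "max 0 (\<tau> - \<epsilon>)" A \<epsilon> d v] assms(3,4) that
    by (auto simp: shift_def)
  have "norm (picard A \<epsilon> d v s - picard A \<epsilon> d v t) \<le> slope_cap T M B * norm (s - t)"
  proof (rule field_differentiable_bound[of "{0..T}"])
    show "(picard A \<epsilon> d v has_field_derivative - slope A (shift \<epsilon> v) r) (at r within {0..T})"
      if "r \<in> {0..T}" for r
      by (rule picard_has_derivative) (use assms cont that in auto)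
    show "norm (- slope A (shift \<epsilon> v) r) \<le> slope_cap T M B" if "r \<in> {0..T}" for r
      using slope_le_cap[of T "shift \<epsilon> v" r M A B] that assms le continuous_on_shift[OF cont assms(3)]
        slope_nonneg[of A "shift \<epsilon> v" r] by (auto simp: admissible_def)
  qed (use assms in auto)
  then show ?thesis using eq assms by simp
qed

text \<open>Arzela-Ascoli applies since the Lipschitz constant \<open>slope_cap T M B\<close>
  depends neither on the delay nor on \<open>k\<close>. The last hypothesis, convergence of the
  coefficients along convergent arguments, yields the equation for the limit.\<close>

lemma solution_compactness:
  assumes "\<And>k. admissible T (A k)" "\<And>k. delayed_solution (A k) (\<epsilon> k) (d k) T (v k)"
    "\<And>k. 0 \<le> \<epsilon> k" "\<epsilon> \<longlonglongrightarrow> 0" "d \<longlonglongrightarrow> d'" "\<And>k. d k \<le> M" "0 \<le> M" "0 \<le> T"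
    "\<And>k s z. s \<in> {0..T} \<Longrightarrow> z \<le> M \<Longrightarrow> A k s z \<le> B"
    "\<And>s x y. s \<in> {0..T} \<Longrightarrow> x \<longlonglongrightarrow> y \<Longrightarrow> (\<And>k. x k \<le> M) \<Longrightarrow> (\<lambda>k. A k s (x k)) \<longlonglongrightarrow> A' s y"
  obtains w h where "delayed_solution A' 0 d' T w" "strict_mono (h :: nat \<Rightarrow> nat)"
    "\<And>s. s \<in> {0..T} \<Longrightarrow> (\<lambda>k. v (h k) s) \<longlonglongrightarrow> w s"
    "\<And>s. s \<in> {0..T} \<Longrightarrow> (\<lambda>k. mass (v (h k)) s) \<longlonglongrightarrow> mass w s"
proof -
  define L where "L = slope_cap T M B"
  have L0: "0 \<le> L" by (simp add: L_def slope_cap_def)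
  have cont: "continuous_on {0..T} (v k)" and eq: "\<And>t. t \<in> {0..T} \<Longrightarrow> v k t = picard (A k) (\<epsilon> k) (d k) (v k) t" for k
    using assms(2) by (auto simp: delayed_solution_def)
  have lip: "\<bar>v k s - v k t\<bar> \<le> L * \<bar>s - t\<bar>" if "s \<in> {0..T}" "t \<in> {0..T}" for k s t
    unfolding L_def by (rule delayed_solution_lipschitz[OF assms(1,2,3,6,7)]) (use assms(9) that in auto)
  have v0: "v k 0 = d k" for k using eq[of 0 k] assms(8) by (simp add: picard_def)
  have le: "v k s \<le> M" if "s \<in> {0..T}" for k s
    using eq[OF that, of k] picard_le[of s "A k" "\<epsilon> k" "d k" "v k"] assms(6)[of k] that by auto
  obtain K where K: "\<And>k. \<bar>d k\<bar> \<le> K"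
    using convergent_imp_Bseq[of d] assms(5) by (auto simp: Bseq_def convergent_def)
  have bound: "norm (v k s) \<le> K + L * T" if "s \<in> {0..T}" for k s
  proof -
    have "L * s \<le> L * T" using that L0 by (intro mult_left_mono) auto
    then show ?thesis using lip[OF that, of 0 k] v0[of k] K[of k] that assms(8) by auto
  qed
  have equi: "\<exists>\<delta>>0. \<forall>k y. y \<in> {0..T} \<and> norm (x - y) < \<delta> \<longrightarrow> norm (v k x - v k y) < e"
    if "x \<in> {0..T}" "0 < e" for x e
  proof (intro exI[of _ "e / (L + 1)"] conjI allI impI)
    show "0 < e / (L + 1)" using that L0 by simp
    fix k y assume y: "y \<in> {0..T} \<and> norm (x - y) < e / (L + 1)"
    have "norm (v k x - v k y) \<le> L * \<bar>x - y\<bar>" using lip[of x y k] y that by simp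
    also have "\<dots> \<le> (L + 1) * \<bar>x - y\<bar>" by (intro mult_right_mono) auto
    also have "\<dots> < e" using y L0 by (simp add: field_simps)
    finally show "norm (v k x - v k y) < e" .
  qed
  obtain w h where w: "continuous_on {0..T} w" and h: "strict_mono (h :: nat \<Rightarrow> nat)"
    and unif: "\<And>e. 0 < e \<Longrightarrow> \<exists>N. \<forall>n x. n \<ge> N \<and> x \<in> {0..T} \<longrightarrow> norm (v (h n) x - w x) < e"
    using Arzela_Ascoli[of "{0..T}" v "K + L * T", OF compact_Icc bound equi] by blast
  have conv: "(\<lambda>k. v (h k) s) \<longlonglongrightarrow> w s" if "s \<in> {0..T}" for s
    unfolding LIMSEQ_iff using unif that by blast
  let ?x = "\<lambda>k. shift (\<epsilon> (h k)) (v (h k))"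
  have h': "filterlim h sequentially sequentially" using h by (rule filterlim_subseq)
  have eps: "(\<lambda>k. \<epsilon> (h k)) \<longlonglongrightarrow> 0" by (rule filterlim_compose[OF assms(4) h'])
  \<comment> \<open>The delayed argument differs from \<open>s\<close> by at most
    \<open>\<epsilon> (h k)\<close>, so by the Lipschitz bound the delayed and undelayed values have
    the same limit.\<close>
  have xconv: "(\<lambda>k. ?x k s) \<longlonglongrightarrow> w s" if "s \<in> {0..T}" for s
  proof -
    have "(\<lambda>k. ?x k s - v (h k) s) \<longlonglongrightarrow> 0"
    proof (rule tendsto_rabs_zero_cancel, rule tendsto_sandwich[of "\<lambda>_. 0"])
      show "\<forall>\<^sub>F k in sequentially. \<bar>?x k s - v (h k) s\<bar> \<le> L * \<epsilon> (h k)"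
      proof (intro always_eventually allI)
        fix k
        have "\<bar>?x k s - v (h k) s\<bar> \<le> L * \<bar>max 0 (s - \<epsilon> (h k)) - s\<bar>"
          unfolding shift_def by (rule lip) (use that assms(3)[of "h k"] in auto)
        also have "\<dots> \<le> L * \<epsilon> (h k)"
          by (intro mult_left_mono L0) (use that assms(3)[of "h k"] in auto)
        finally show "\<bar>?x k s - v (h k) s\<bar> \<le> L * \<epsilon> (h k)" .
      qed
      show "(\<lambda>k. L * \<epsilon> (h k)) \<longlonglongrightarrow> 0" using tendsto_mult_left[OF eps, of L] by simp
    qed auto
    from tendsto_add[OF this conv[OF that]] show ?thesis by simp
  qed
  have xle: "?x k s \<le> M" if "s \<in> {0..T}" for k s
    unfolding shift_def by (rule le) (use that assms(3)[of "h k"] in auto)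
  have Aconv: "(\<lambda>k. A (h k) s (?x k s)) \<longlonglongrightarrow> A' s (w s)" if s: "s \<in> {0..T}" for s
  proof -
    txt \<open>The hypothesis on \<open>A\<close> is about full sequences, so the subsequence is filled up by its limit.\<close>
    define y where "y n = (if n \<in> range h then ?x (inv h n) s else w s)" for n
    have yh: "y (h k) = ?x k s" for k
      using h by (simp add: y_def inv_f_f strict_mono_imp_inj_on)
    have wM: "w s \<le> M" using LIMSEQ_le_const2[OF conv[OF s]] le[OF s] by blast
    have "y \<longlonglongrightarrow> w s"
    proof (rule LIMSEQ_I)
      fix r :: real assume "0 < r"
      then obtain N where N: "\<And>k. k \<ge> N \<Longrightarrow> norm (?x k s - w s) < r"
        using xconv[OF s] unfolding LIMSEQ_iff by blast
      have "norm (y n - w s) < r" if "n \<ge> h N" for n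
      proof (cases "n \<in> range h")
        case True
        then obtain k where k: "n = h k" by auto
        then have "k \<ge> N" using that h by (simp add: strict_mono_less_eq)
        then show ?thesis using N k yh by simp
      qed (use \<open>0 < r\<close> in \<open>simp add: y_def\<close>)
      then show "\<exists>no. \<forall>n\<ge>no. norm (y n - w s) < r" by blast
    qed
    then have "(\<lambda>n. A n s (y n)) \<longlonglongrightarrow> A' s (w s)"
      by (rule assms(10)[OF s]) (use wM xle[OF s] in \<open>auto simp: y_def\<close>)
    from filterlim_compose[OF this h'] show ?thesis by (simp add: yh)
  qed
  have "w t = picard A' 0 d' w t" if t: "t \<in> {0..T}" for t
  proof -
    have "(\<lambda>k. integral {0..t} (slope (A (h k)) (?x k))) \<longlonglongrightarrow> integral {0..t} (slope A' w)"
      by (rule slope_integral_tendsto[where M = M and B = B and T = T])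
         (use xle xconv Aconv t assms cont in \<open>auto intro!: continuous_on_shift\<close>)
    moreover have "(\<lambda>k. d (h k)) \<longlonglongrightarrow> d'" by (rule filterlim_compose[OF assms(5) h'])
    ultimately have "(\<lambda>k. picard (A (h k)) (\<epsilon> (h k)) (d (h k)) (v (h k)) t) \<longlonglongrightarrow> d' - integral {0..t} (slope A' w)"
      unfolding picard_def by (intro tendsto_intros)
    then have "(\<lambda>k. v (h k) t) \<longlonglongrightarrow> d' - integral {0..t} (slope A' w)" using eq[OF t] by simp
    with conv[OF t] have "w t = d' - integral {0..t} (slope A' w)" by (rule LIMSEQ_unique)
    moreover have "integral {0..t} (slope A' (shift 0 w)) = integral {0..t} (slope A' w)"
      by (intro Henstock_Kurzweil_Integration.integral_cong slope_cong) (auto simp: shift_def)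
    ultimately show ?thesis by (simp add: picard_def)
  qed
  then have "delayed_solution A' 0 d' T w" using w by (simp add: delayed_solution_def)
  moreover have "(\<lambda>k. mass (v (h k)) s) \<longlonglongrightarrow> mass w s" if "s \<in> {0..T}" for s
    by (rule mass_tendsto[where M = M and T = T]) (use cont le conv that in auto)
  ultimately show thesis using that h conv by blast
qed

end

section \<open>A Liouville theorem on long intervals\<close>

text \<open>First-order form of \<open>(t powr \<theta> * \<bar>u'\<bar> powr (m - 2) * u')' = - c *
  t powr \<sigma> * u powr q\<close>, with \<open>P\<close> minus the flux. By
  \<open>subcritical\<close>, \<open>q + 1\<close> lies below the critical exponent
  \<open>m * (\<sigma> + 1) / (\<theta> + 1 - m)\<close>.\<close>

locale emden_solution =
  fixes m \<theta> \<sigma> q c T :: real and u P :: "real \<Rightarrow> real"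
  assumes m_gt_1: "m > 1" and theta_gt: "\<theta> > m - 1" and sigma_gt: "\<sigma> > \<theta> - 1" and q_gt: "q > m - 1"
    and subcritical: "(q + 1) * (\<theta> + 1 - m) < m * (\<sigma> + 1)" and c_pos: "c > 0" and T_pos: "T > 0"
    and cont_u: "continuous_on {0..T} u" and cont_P: "continuous_on {0..T} P"
    and u_0: "u 0 = 1" and P_0: "P 0 = 0"
    and u_pos: "\<And>t. 0 < t \<Longrightarrow> t < T \<Longrightarrow> u t > 0"
    and u_deriv: "\<And>t. 0 < t \<Longrightarrow> t < T \<Longrightarrow>
      (u has_real_derivative - ((t powr - \<theta> * P t) powr (1 / (m - 1)))) (at t)"
    and P_deriv: "\<And>t. 0 < t \<Longrightarrow> t < T \<Longrightarrow> (P has_real_derivative c * t powr \<sigma> * u t powr q) (at t)"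
begin

section \<open>Growth and decay of Emden--Fowler solutions\<close>

lemma exps: "\<sigma> > -1" "q > 0" "\<theta> > 0"
  using m_gt_1 theta_gt sigma_gt q_gt by auto

lemma u_antimono: "0 \<le> s \<Longrightarrow> s \<le> t \<Longrightarrow> t \<le> T \<Longrightarrow> u t \<le> u s"
  by (rule DERIV_nonpos_imp_decreasing_open)
     (auto intro!: exI u_deriv intro: continuous_on_subset[OF cont_u])

lemma u_le_1: "0 \<le> t \<Longrightarrow> t \<le> T \<Longrightarrow> u t \<le> 1"
  using u_antimono[of 0 t] u_0 by simp

lemma u_nonneg: "0 \<le> t \<Longrightarrow> t < T \<Longrightarrow> 0 \<le> u t"
  using u_pos[of t] u_0 by (cases "t = 0") auto

lemma powr_sigma_deriv:
  "0 < s \<Longrightarrow> ((\<lambda>s. k * s powr (\<sigma> + 1) / (\<sigma> + 1)) has_real_derivative k * s powr \<sigma>) (at s)" for k :: real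
  using exps by (auto intro!: derivative_eq_intros)

lemma powr_sigma_cont: "continuous_on S (\<lambda>s. k * s powr (\<sigma> + 1) / (\<sigma> + 1))" if "S \<subseteq> {0..}" for k :: real
  using exps that by (intro continuous_intros continuous_on_powr') auto

text \<open>Since \<open>u\<close> decreases, \<open>u s powr q\<close> is at least
  \<open>u t powr q\<close> for \<open>s \<le> t\<close>; the difference of the two sides then has
  nonnegative derivative in \<open>s\<close>.\<close>

lemma P_ge:
  assumes "0 \<le> t" "t < T"
  shows "c * u t powr q * t powr (\<sigma> + 1) / (\<sigma> + 1) \<le> P t"
proof -
  let ?f = "\<lambda>s. P s - c * u t powr q * s powr (\<sigma> + 1) / (\<sigma> + 1)"
  have "?f 0 \<le> ?f t"
  proof (rule DERIV_nonneg_imp_increasing_open[OF assms(1)])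
    fix s assume s: "0 < s" "s < t"
    show "\<exists>y. (?f has_real_derivative y) (at s) \<and> 0 \<le> y"
    proof (intro exI conjI)
      show "(?f has_real_derivative c * s powr \<sigma> * u s powr q - c * u t powr q * s powr \<sigma>) (at s)"
        by (intro DERIV_diff P_deriv powr_sigma_deriv) (use s assms in auto)
      have "u t powr q \<le> u s powr q"
        using u_antimono[of s t] u_nonneg[of t] s assms exps by (intro powr_mono2) auto
      then have "c * s powr \<sigma> * u t powr q \<le> c * s powr \<sigma> * u s powr q"
        using c_pos by (intro mult_left_mono) auto
      then show "0 \<le> c * s powr \<sigma> * u s powr q - c * u t powr q * s powr \<sigma>"
        by (simp add: mult_ac)
    qed
  next
    show "continuous_on {0..t} ?f"
      by (intro continuous_on_diff powr_sigma_cont continuous_on_subset[OF cont_P]) (use assms in auto)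
  qed
  then show ?thesis using P_0 exps by simp
qed

lemma P_le:
  assumes "0 \<le> t" "t < T"
  shows "P t \<le> c * t powr (\<sigma> + 1) / (\<sigma> + 1)"
proof -
  let ?f = "\<lambda>s. P s - c * s powr (\<sigma> + 1) / (\<sigma> + 1)"
  have "?f t \<le> ?f 0"
  proof (rule DERIV_nonpos_imp_decreasing_open[OF assms(1)])
    fix s assume s: "0 < s" "s < t"
    show "\<exists>y. (?f has_real_derivative y) (at s) \<and> y \<le> 0"
    proof (intro exI conjI)
      show "(?f has_real_derivative c * s powr \<sigma> * u s powr q - c * s powr \<sigma>) (at s)"
        by (intro DERIV_diff P_deriv powr_sigma_deriv) (use s assms in auto)
      have "u s powr q \<le> 1"
        using u_le_1[of s] u_nonneg[of s] s assms exps by (intro powr_le1) auto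
      then have "c * s powr \<sigma> * u s powr q \<le> c * s powr \<sigma> * 1"
        using c_pos by (intro mult_left_mono) auto
      then show "c * s powr \<sigma> * u s powr q - c * s powr \<sigma> \<le> 0" by simp
    qed
  next
    show "continuous_on {0..t} ?f"
      by (intro continuous_on_diff powr_sigma_cont continuous_on_subset[OF cont_P]) (use assms in auto)
  qed
  then show ?thesis using P_0 exps by simp
qed

lemma P_pos: "0 < t \<Longrightarrow> t < T \<Longrightarrow> 0 < P t"
  by (rule less_le_trans[OF _ P_ge]) (use c_pos exps u_pos[of t] in auto)

lemma P_mono: "0 \<le> s \<Longrightarrow> s \<le> t \<Longrightarrow> t < T \<Longrightarrow> P s \<le> P t"
  by (rule DERIV_nonneg_imp_increasing_open, assumption, rule exI, rule conjI, rule P_deriv)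
     (use c_pos in \<open>auto intro: continuous_on_subset[OF cont_P]\<close>)

text \<open>By \<open>P_le\<close> and \<open>\<sigma> + 1 > \<theta>\<close> the slope up to 1 is
  bounded by a constant depending only on the parameters. This keeps \<open>u\<close> above 1/2 on
  an initial interval whose length is known in advance.\<close>

lemma u_lower:
  assumes "0 < t" "t < T" "t \<le> 1"
  shows "1 - (c / (\<sigma> + 1)) powr (1 / (m - 1)) * t \<le> u t"
proof -
  let ?K = "(c / (\<sigma> + 1)) powr (1 / (m - 1))"
  let ?f = "\<lambda>s. u s + ?K * s"
  have "?f 0 \<le> ?f t"
  proof (rule DERIV_nonneg_imp_increasing_open[of 0 t ?f])
    fix s assume s: "0 < s" "s < t"
    show "\<exists>y. (?f has_real_derivative y) (at s) \<and> 0 \<le> y"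
    proof (intro exI conjI)
      show "(?f has_real_derivative - ((s powr - \<theta> * P s) powr (1 / (m - 1))) + ?K) (at s)"
        by (rule derivative_eq_intros u_deriv refl | use s assms in simp)+
      have "s powr - \<theta> * P s \<le> s powr - \<theta> * (c * s powr (\<sigma> + 1) / (\<sigma> + 1))"
        by (intro mult_left_mono P_le) (use s assms in auto)
      also have "\<dots> = c / (\<sigma> + 1) * (s powr (-\<theta> + (\<sigma> + 1)))"
        by (subst powr_add) simp
      also have "\<dots> \<le> c / (\<sigma> + 1) * 1"
        by (intro mult_left_mono powr_le1) (use s assms sigma_gt c_pos exps in auto)
      finally have "(s powr - \<theta> * P s) powr (1 / (m - 1)) \<le> ?K"
        using P_pos[of s] s assms m_gt_1 by (intro powr_mono2) auto
      then show "0 \<le> - ((s powr - \<theta> * P s) powr (1 / (m - 1))) + ?K" by simp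
    qed
  qed (use assms in \<open>auto intro!: continuous_intros continuous_on_subset[OF cont_u]\<close>)
  then show ?thesis using u_0 by simp
qed

text \<open>Mean value theorem on \<open>{s..2 * s}\<close>: positivity of \<open>u (2 * s)\<close>
  limits the drop of \<open>u\<close> to \<open>u s\<close>, while the slope on this interval is at
  least \<open>((2 * s) powr - \<theta> * P s) powr (1 / (m - 1))\<close>.\<close>

lemma P_le_u:
  assumes "0 < s" "2 * s < T"
  shows "P s \<le> 2 powr \<theta> * s powr (\<theta> + 1 - m) * u s powr (m - 1)"
proof -
  have "\<exists>z. z > s \<and> z < 2 * s \<and> u (2 * s) - u s = (2 * s - s) * - ((z powr - \<theta> * P z) powr (1 / (m - 1)))"
    by (rule MVT2) (use assms in \<open>auto intro!: u_deriv\<close>)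
  then obtain z where z: "s < z" "z < 2 * s"
    and eq: "u (2 * s) - u s = s * - ((z powr - \<theta> * P z) powr (1 / (m - 1)))" by auto
  have "(2 * s) powr - \<theta> * P s \<le> z powr - \<theta> * P z"
    using z assms exps P_pos[of s] by (intro mult_mono powr_mono2' P_mono) auto
  then have "((2 * s) powr - \<theta> * P s) powr (1 / (m - 1)) \<le> (z powr - \<theta> * P z) powr (1 / (m - 1))"
    using m_gt_1 P_pos[of s] assms by (intro powr_mono2) auto
  then have "s * ((2 * s) powr - \<theta> * P s) powr (1 / (m - 1)) \<le> s * (z powr - \<theta> * P z) powr (1 / (m - 1))"
    using assms by (intro mult_left_mono) auto
  also have "\<dots> \<le> u s" using eq u_pos[of "2 * s"] assms by auto
  finally have "(s * ((2 * s) powr - \<theta> * P s) powr (1 / (m - 1))) powr (m - 1) \<le> u s powr (m - 1)"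
    using m_gt_1 assms by (intro powr_mono2) auto
  also have "(s * ((2 * s) powr - \<theta> * P s) powr (1 / (m - 1))) powr (m - 1) =
      s powr (m - 1) * ((2 * s) powr - \<theta> * P s)"
    using assms P_pos[of s] m_gt_1 by (simp add: powr_mult powr_powr)
  also have "\<dots> = s powr (m - 1 - \<theta>) * 2 powr - \<theta> * P s"
  proof -
    have "(2 * s) powr - \<theta> = 2 powr - \<theta> * s powr - \<theta>" using assms by (simp add: powr_mult)
    moreover have "s powr (m - 1 - \<theta>) = s powr (m - 1) * s powr - \<theta>"
      unfolding powr_add[symmetric] by simp
    ultimately show ?thesis by (simp only: mult_ac)
  qed
  finally have "s powr (m - 1 - \<theta>) * 2 powr - \<theta> * P s \<le> u s powr (m - 1)" .
  then have "2 powr \<theta> * s powr (\<theta> + 1 - m) * (s powr (m - 1 - \<theta>) * 2 powr - \<theta> * P s)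
      \<le> 2 powr \<theta> * s powr (\<theta> + 1 - m) * u s powr (m - 1)"
    by (intro mult_left_mono) auto
  also have "2 powr \<theta> * s powr (\<theta> + 1 - m) * (s powr (m - 1 - \<theta>) * 2 powr - \<theta> * P s) =
      (2 powr \<theta> * 2 powr - \<theta>) * (s powr (\<theta> + 1 - m) * s powr (m - 1 - \<theta>)) * P s" by (simp add: mult_ac)
  also have "\<dots> = P s"
    using assms by (simp flip: powr_add)
  finally show ?thesis .
qed

text \<open>The lower bound \<open>P_ge\<close> and the upper bound \<open>P_le_u\<close> for the
  same \<open>P s\<close> are compared; cancelling \<open>u s powr (m - 1)\<close> leaves a negative
  power of \<open>s\<close>.\<close>

lemma u_decay:
  assumes "0 < s" "2 * s < T"
  shows "u s powr (q - m + 1) \<le> 2 powr \<theta> * (\<sigma> + 1) / c * s powr (\<theta> - m - \<sigma>)"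
proof -
  have us: "0 < u s" using u_pos[of s] assms by auto
  have "c * u s powr q * s powr (\<sigma> + 1) / (\<sigma> + 1) \<le> 2 powr \<theta> * s powr (\<theta> + 1 - m) * u s powr (m - 1)"
    using P_ge[of s] P_le_u[OF assms] assms by auto
  also have "q = (q - m + 1) + (m - 1)" by simp
  also have "u s powr ((q - m + 1) + (m - 1)) = u s powr (q - m + 1) * u s powr (m - 1)" by (rule powr_add)
  finally have "u s powr (m - 1) * (c * u s powr (q - m + 1) * s powr (\<sigma> + 1) / (\<sigma> + 1))
      \<le> u s powr (m - 1) * (2 powr \<theta> * s powr (\<theta> + 1 - m))" by (simp add: mult_ac)
  then have "c * u s powr (q - m + 1) * s powr (\<sigma> + 1) / (\<sigma> + 1) \<le> 2 powr \<theta> * s powr (\<theta> + 1 - m)"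
    using us by (subst (asm) mult_le_cancel_left_pos) auto
  then have "u s powr (q - m + 1) \<le> 2 powr \<theta> * (\<sigma> + 1) / c * (s powr (\<theta> + 1 - m) / s powr (\<sigma> + 1))"
    using c_pos exps assms by (simp add: field_simps)
  also have "s powr (\<theta> + 1 - m) / s powr (\<sigma> + 1) = s powr (\<theta> - m - \<sigma>)"
    by (simp flip: powr_diff add: algebra_simps)
  finally show ?thesis .
qed

text \<open>The weight of \<open>u P\<close> is the one for which the terms in \<open>- u' P\<close> cancel in the derivative of the
  Pohozaev functional; what remains is a multiple \<open>gap\<close> of \<open>t powr \<sigma> * u powr (q + 1)\<close>, and
  \<open>gap\<close> is positive exactly in the subcritical range.\<close>

definition pohozaev_weight :: real where "pohozaev_weight = (\<theta> + 1 - m) / m"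

definition pohozaev :: "real \<Rightarrow> real" where
  "pohozaev t = (m - 1) / m * (t powr (1 - \<theta> / (m - 1)) * P t powr (m / (m - 1)))
     + c * t powr (\<sigma> + 1) * u t powr (q + 1) / (q + 1) - pohozaev_weight * u t * P t"

definition gap :: real where "gap = (\<sigma> + 1) / (q + 1) - pohozaev_weight"

lemma gap_pos: "0 < gap"
proof -
  have "\<theta> + 1 - m < m * (\<sigma> + 1) / (q + 1)"
    using subcritical exps by (subst pos_less_divide_eq) (auto simp: mult.commute)
  then have "(\<theta> + 1 - m) / m < m * (\<sigma> + 1) / (q + 1) / m"
    using m_gt_1 by (intro divide_strict_right_mono) auto
  then show ?thesis using m_gt_1 by (simp add: gap_def pohozaev_weight_def)
qed

lemma pohozaev_weight_pos: "0 < pohozaev_weight"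
  using theta_gt m_gt_1 by (simp add: pohozaev_weight_def)

lemma pohozaev_deriv:
  assumes "0 < t" "t < T"
  shows "(pohozaev has_real_derivative c * gap * (t powr \<sigma> * u t powr (q + 1))) (at t)"
proof -
  define y where "y = (t powr - \<theta> * P t) powr (1 / (m - 1))"
  define X where "X = t powr \<sigma>"
  define Y where "Y = u t powr q"
  have pos: "0 < u t" "0 < P t" using u_pos P_pos assms by auto
  have du: "(u has_real_derivative - y) (at t)" unfolding y_def by (rule u_deriv) (use assms in auto)
  have dP: "(P has_real_derivative c * X * Y) (at t)" unfolding X_def Y_def by (rule P_deriv) (use assms in auto)
  have y: "y = t powr (- \<theta> / (m - 1)) * P t powr (1 / (m - 1))"
    using pos assms by (simp add: y_def powr_mult powr_powr)
  have e1: "t powr (1 - \<theta> / (m - 1)) = t * t powr (- \<theta> / (m - 1))"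
    using assms by (simp add: powr_diff powr_minus field_simps)
  have e2: "m / (m - 1) = 1 + 1 / (m - 1)" using m_gt_1 by (simp add: field_simps)
  have e3: "P t powr (m / (m - 1)) = P t * P t powr (1 / (m - 1))"
    unfolding e2 using pos by (simp add: powr_add)
  have "((\<lambda>t. t powr (1 - \<theta> / (m - 1)) * P t powr (m / (m - 1))) has_real_derivative
      (1 - \<theta> / (m - 1)) * t powr (1 - \<theta> / (m - 1) - 1) * P t powr (m / (m - 1)) +
      t powr (1 - \<theta> / (m - 1)) * (m / (m - 1) * P t powr (m / (m - 1) - 1) * (c * X * Y))) (at t)"
    using assms pos by (auto intro!: derivative_eq_intros dP)
  also have "m / (m - 1) - 1 = 1 / (m - 1)" using m_gt_1 by (simp add: field_simps)
  also have "1 - \<theta> / (m - 1) - 1 = - \<theta> / (m - 1)" by simp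
  finally have d1: "((\<lambda>t. t powr (1 - \<theta> / (m - 1)) * P t powr (m / (m - 1))) has_real_derivative
      (1 - \<theta> / (m - 1)) * (y * P t) + m / (m - 1) * (t * y * (c * X * Y))) (at t)"
    unfolding e3 e1 y by (simp add: algebra_simps)
  have "((\<lambda>t. c * t powr (\<sigma> + 1) * u t powr (q + 1) / (q + 1)) has_real_derivative
     (c * ((\<sigma> + 1) * X) * u t powr (q + 1) + c * t powr (\<sigma> + 1) * ((q + 1) * Y * - y)) / (q + 1)) (at t)"
    unfolding X_def Y_def using assms pos exps by (auto intro!: derivative_eq_intros du)
  then have d2: "((\<lambda>t. c * t powr (\<sigma> + 1) * u t powr (q + 1) / (q + 1)) has_real_derivative
     (c * ((\<sigma> + 1) * X) * (u t * Y) + c * (t * X) * ((q + 1) * Y * - y)) / (q + 1)) (at t)"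
    unfolding X_def Y_def using assms pos by (simp add: powr_add mult_ac)
  have d3: "((\<lambda>t. pohozaev_weight * u t * P t) has_real_derivative pohozaev_weight * (u t * (c * X * Y) - y * P t)) (at t)"
    by (rule derivative_eq_intros du dP refl)+ (simp add: algebra_simps)
  have "(pohozaev has_real_derivative
     (m - 1) / m * ((1 - \<theta> / (m - 1)) * (y * P t) + m / (m - 1) * (t * y * (c * X * Y)))
     + (c * ((\<sigma> + 1) * X) * (u t * Y) + c * (t * X) * ((q + 1) * Y * - y)) / (q + 1)
     - pohozaev_weight * (u t * (c * X * Y) - y * P t)) (at t)"
    unfolding pohozaev_def by (intro DERIV_diff DERIV_add DERIV_cmult d1 d2 d3)
  \<comment> \<open>The coefficient \<open>(m - 1) / m * (1 - \<theta> / (m - 1))\<close> equals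
    \<open>- pohozaev_weight\<close>; this identity dictates the weight.\<close>
  also have "(m - 1) / m * ((1 - \<theta> / (m - 1)) * (y * P t) + m / (m - 1) * (t * y * (c * X * Y)))
     = - pohozaev_weight * (y * P t) + t * y * (c * X * Y)"
    using m_gt_1 unfolding pohozaev_weight_def by (simp add: divide_simps) (simp add: algebra_simps)
  also have "(c * ((\<sigma> + 1) * X) * (u t * Y) + c * (t * X) * ((q + 1) * Y * - y)) / (q + 1)
     = (\<sigma> + 1) / (q + 1) * c * X * (u t * Y) - c * t * X * Y * y"
    using exps by (simp add: field_simps)
  \<comment> \<open>The multiples of \<open>y * P t\<close> cancel, and so do those of
    \<open>t * X * Y * y\<close>; the terms in \<open>X * (u t * Y)\<close> add up to
    \<open>c * gap\<close>.\<close>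
  finally have "(pohozaev has_real_derivative c * gap * (X * (u t * Y))) (at t)"
    by (rule DERIV_cong) (simp add: gap_def algebra_simps)
  then show ?thesis using pos by (simp add: X_def Y_def powr_add mult_ac)
qed

section \<open>Lower and upper bounds for the Pohozaev functional\<close>

lemma pohozaev_mono:
  assumes "0 < s" "s \<le> t" "t < T"
  shows "pohozaev s \<le> pohozaev t"
proof (rule DERIV_nonneg_imp_nondecreasing[OF assms(2)])
  fix r assume "s \<le> r" "r \<le> t"
  then have "0 < r" "r < T" using assms by auto
  from pohozaev_deriv[OF this] show "\<exists>y. (pohozaev has_real_derivative y) (at r) \<and> 0 \<le> y"
    using c_pos gap_pos by (auto intro!: exI)
qed

text \<open>Up to \<open>t\<close> one has \<open>u \<ge> 1/2\<close>, so the derivative of the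
  functional is at least \<open>k * r powr \<sigma>\<close>. The comparison starts from the limit at
  0.\<close>

lemma pohozaev_ge:
  assumes "0 < t" "t < T" "1/2 \<le> u t"
  shows "c * gap * (1/2) powr (q + 1) * t powr (\<sigma> + 1) / (\<sigma> + 1) \<le> pohozaev t"
proof -
  define k where "k = c * gap * (1/2) powr (q + 1)"
  let ?f = "\<lambda>s. pohozaev s - k * s powr (\<sigma> + 1) / (\<sigma> + 1)"
  have mono: "?f s \<le> ?f t" if "0 < s" "s \<le> t" for s
  proof (rule DERIV_nonneg_imp_nondecreasing[OF that(2)])
    fix r assume r: "s \<le> r" "r \<le> t"
    then have "0 < r" "r < T" using assms that by auto
    then have "(?f has_real_derivative c * gap * (r powr \<sigma> * u r powr (q + 1)) - k * r powr \<sigma>) (at r)"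
      by (intro DERIV_diff pohozaev_deriv powr_sigma_deriv)
    moreover have "(1/2) powr (q + 1) \<le> u r powr (q + 1)"
      using u_antimono[of r t] r assms that exps by (intro powr_mono2) auto
    then have "c * gap * r powr \<sigma> * (1/2) powr (q + 1) \<le> c * gap * r powr \<sigma> * u r powr (q + 1)"
      using c_pos gap_pos by (intro mult_left_mono) auto
    then have "k * r powr \<sigma> \<le> c * gap * (r powr \<sigma> * u r powr (q + 1))" by (simp add: k_def mult_ac)
    ultimately show "\<exists>y. (?f has_real_derivative y) (at r) \<and> 0 \<le> y" by (auto intro!: exI)
  qed
  \<comment> \<open>The two nonnegative terms, one with a negative power of \<open>s\<close>, are
    dropped. What is left tends to 0 with \<open>s\<close>, so no limit of the functional itself has
    to be computed.\<close>
  have lower: "- pohozaev_weight * P s - k * s powr (\<sigma> + 1) / (\<sigma> + 1) \<le> ?f t" if "0 < s" "s \<le> t" for s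
  proof -
    have "u s * P s \<le> 1 * P s"
      using u_le_1[of s] P_pos[of s] that assms by (intro mult_right_mono) auto
    then have "pohozaev_weight * (u s * P s) \<le> pohozaev_weight * P s" using pohozaev_weight_pos by simp
    moreover have "0 \<le> (m - 1) / m * (s powr (1 - \<theta> / (m - 1)) * P s powr (m / (m - 1)))
        + c * s powr (\<sigma> + 1) * u s powr (q + 1) / (q + 1)"
      using m_gt_1 c_pos exps by (intro add_nonneg_nonneg) auto
    ultimately have "- pohozaev_weight * P s \<le> pohozaev s" by (simp add: pohozaev_def mult_ac)
    then show ?thesis using mono[OF that] by simp
  qed
  have "0 \<le> ?f t"
  proof (rule tendsto_upperbound)
    have "continuous_on {0..T} (\<lambda>s. - pohozaev_weight * P s - k * s powr (\<sigma> + 1) / (\<sigma> + 1))"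
      by (intro continuous_on_diff powr_sigma_cont continuous_on_mult cont_P continuous_on_const) auto
    then have "((\<lambda>s. - pohozaev_weight * P s - k * s powr (\<sigma> + 1) / (\<sigma> + 1)) \<longlongrightarrow> - pohozaev_weight * P 0 - k * 0 powr (\<sigma> + 1) / (\<sigma> + 1))
        (at 0 within {0..T})" using T_pos unfolding continuous_on_def by (intro bspec[of _ _ 0]) auto
    then show "((\<lambda>s. - pohozaev_weight * P s - k * s powr (\<sigma> + 1) / (\<sigma> + 1)) \<longlongrightarrow> 0) (at_right 0)"
      using P_0 exps T_pos by (simp add: at_within_Icc_at_right)
    show "\<forall>\<^sub>F s in at_right 0. - pohozaev_weight * P s - k * s powr (\<sigma> + 1) / (\<sigma> + 1) \<le> ?f t"
      using eventually_at_right_real[OF assms(1)]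
      by eventually_elim (use lower assms in auto)
  qed simp
  then show ?thesis by (simp add: k_def)
qed

text \<open>By \<open>P_le_u\<close> and \<open>u_decay\<close> both positive terms are at most a
  constant times \<open>s powr (\<theta> + 1 - m) * u s powr m\<close>; the decay of
  \<open>u\<close> turns this into a power of \<open>s\<close>. Its exponent is negative exactly in
  the subcritical range.\<close>

lemma pohozaev_le:
  assumes "0 < s" "2 * s < T"
  defines "C1 \<equiv> 2 powr \<theta> * (\<sigma> + 1) / c"
  shows "pohozaev s \<le> ((m - 1) / m * 2 powr (\<theta> * (m / (m - 1))) + c * C1 / (q + 1))
     * C1 powr (m / (q - m + 1)) * s powr ((\<theta> + 1 - m) - (\<sigma> + m - \<theta>) * (m / (q - m + 1)))"
proof -
  have pos: "0 < u s" "0 < P s" using u_pos[of s] P_pos[of s] assms by auto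
  have C1: "0 < C1" using c_pos exps by (simp add: C1_def)
  have "P s powr (m / (m - 1)) \<le> (2 powr \<theta> * s powr (\<theta> + 1 - m) * u s powr (m - 1)) powr (m / (m - 1))"
    using P_le_u[OF assms(1,2)] pos m_gt_1 by (intro powr_mono2) auto
  also have "\<dots> = 2 powr (\<theta> * (m / (m - 1))) * s powr ((\<theta> + 1 - m) * (m / (m - 1))) * u s powr m"
    using m_gt_1 pos assms by (simp add: powr_mult powr_powr)
  finally have "s powr (1 - \<theta> / (m - 1)) * P s powr (m / (m - 1)) \<le>
      s powr (1 - \<theta> / (m - 1)) * (2 powr (\<theta> * (m / (m - 1))) * s powr ((\<theta> + 1 - m) * (m / (m - 1))) * u s powr m)"
    by (intro mult_left_mono) auto
  also have "\<dots> = 2 powr (\<theta> * (m / (m - 1))) * (s powr (1 - \<theta> / (m - 1)) * s powr ((\<theta> + 1 - m) * (m / (m - 1)))) * u s powr m"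
    by (simp add: mult_ac)
  also have "s powr (1 - \<theta> / (m - 1)) * s powr ((\<theta> + 1 - m) * (m / (m - 1))) = s powr (\<theta> + 1 - m)"
  proof -
    have "1 - \<theta> / (m - 1) + (\<theta> + 1 - m) * (m / (m - 1)) = \<theta> + 1 - m"
      using m_gt_1 by (simp add: divide_simps) (simp add: algebra_simps)
    then show ?thesis unfolding powr_add[symmetric] by (simp only:)
  qed
  finally have t1: "s powr (1 - \<theta> / (m - 1)) * P s powr (m / (m - 1)) \<le>
      2 powr (\<theta> * (m / (m - 1))) * (s powr (\<theta> + 1 - m) * u s powr m)" by (simp add: mult_ac)
  have decay: "u s powr (q - m + 1) \<le> C1 * s powr (\<theta> - m - \<sigma>)"
    using u_decay[OF assms(1,2)] by (simp add: C1_def)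
  have "q + 1 = (q - m + 1) + m" by simp
  then have "u s powr (q + 1) = u s powr (q - m + 1) * u s powr m" by (metis powr_add)
  also have "\<dots> \<le> C1 * s powr (\<theta> - m - \<sigma>) * u s powr m" by (intro mult_right_mono decay) auto
  finally have "s powr (\<sigma> + 1) * u s powr (q + 1) \<le> s powr (\<sigma> + 1) * (C1 * s powr (\<theta> - m - \<sigma>) * u s powr m)"
    by (intro mult_left_mono) auto
  also have "\<dots> = C1 * (s powr (\<sigma> + 1) * s powr (\<theta> - m - \<sigma>)) * u s powr m" by (simp add: mult_ac)
  also have "s powr (\<sigma> + 1) * s powr (\<theta> - m - \<sigma>) = s powr (\<theta> + 1 - m)"
    by (simp flip: powr_add add: algebra_simps)
  finally have t2: "s powr (\<sigma> + 1) * u s powr (q + 1) \<le> C1 * (s powr (\<theta> + 1 - m) * u s powr m)"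
    by (simp add: mult_ac)
  have "u s powr m = (u s powr (q - m + 1)) powr (m / (q - m + 1))"
    using q_gt by (simp add: powr_powr)
  also have "\<dots> \<le> (C1 * s powr (\<theta> - m - \<sigma>)) powr (m / (q - m + 1))"
    using decay m_gt_1 q_gt by (intro powr_mono2) auto
  also have "\<theta> - m - \<sigma> = - (\<sigma> + m - \<theta>)" by simp
  also have "(C1 * s powr - (\<sigma> + m - \<theta>)) powr (m / (q - m + 1)) =
      C1 powr (m / (q - m + 1)) * s powr (- (\<sigma> + m - \<theta>) * (m / (q - m + 1)))"
    using C1 by (simp add: powr_mult powr_powr)
  finally have "s powr (\<theta> + 1 - m) * u s powr m \<le>
      s powr (\<theta> + 1 - m) * (C1 powr (m / (q - m + 1)) * s powr (- (\<sigma> + m - \<theta>) * (m / (q - m + 1))))"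
    by (intro mult_left_mono) auto
  also have "\<dots> = C1 powr (m / (q - m + 1)) * s powr ((\<theta> + 1 - m) + - (\<sigma> + m - \<theta>) * (m / (q - m + 1)))"
    by (subst powr_add) (simp only: mult_ac)
  finally have t3: "s powr (\<theta> + 1 - m) * u s powr m \<le>
      C1 powr (m / (q - m + 1)) * s powr ((\<theta> + 1 - m) - (\<sigma> + m - \<theta>) * (m / (q - m + 1)))" by (simp only: mult_minus_left add_uminus_conv_diff)
  let ?Q = "s powr (\<theta> + 1 - m) * u s powr m"
  have "0 \<le> pohozaev_weight * u s * P s" using pohozaev_weight_pos pos by simp
  then have "pohozaev s \<le> (m - 1) / m * (s powr (1 - \<theta> / (m - 1)) * P s powr (m / (m - 1)))
     + c * (s powr (\<sigma> + 1) * u s powr (q + 1)) / (q + 1)"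
    by (simp add: pohozaev_def mult_ac)
  also have "\<dots> \<le> (m - 1) / m * (2 powr (\<theta> * (m / (m - 1))) * ?Q) + c * (C1 * ?Q) / (q + 1)"
    using t1 t2 m_gt_1 c_pos exps by (intro add_mono mult_left_mono divide_right_mono) auto
  also have "\<dots> = ((m - 1) / m * 2 powr (\<theta> * (m / (m - 1))) + c * C1 / (q + 1)) * ?Q"
    by (simp add: algebra_simps)
  also have "\<dots> \<le> ((m - 1) / m * 2 powr (\<theta> * (m / (m - 1))) + c * C1 / (q + 1)) *
     (C1 powr (m / (q - m + 1)) * s powr ((\<theta> + 1 - m) - (\<sigma> + m - \<theta>) * (m / (q - m + 1))))"
    using m_gt_1 C1 c_pos exps by (intro mult_left_mono t3) auto
  finally show ?thesis by (simp add: mult_ac)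
qed

end

text \<open>All constants depend only on the parameters, so \<open>T\<close> can be fixed before
  \<open>u\<close> and \<open>P\<close>: the functional is at least \<open>e0\<close> at
  \<open>t0\<close>, does not decrease, and would be below \<open>e0\<close> at a large
  \<open>s\<close>.\<close>

lemma emden_liouville:
  assumes "m > 1" "\<theta> > m - 1" "\<sigma> > \<theta> - 1" "q > m - 1" "(q + 1) * (\<theta> + 1 - m) < m * (\<sigma> + 1)" "c > 0"
  shows "\<exists>T>0. \<forall>u P. \<not> emden_solution m \<theta> \<sigma> q c T u P"
proof -
  define K where "K = (c / (\<sigma> + 1)) powr (1 / (m - 1))"
  \<comment> \<open>Chosen so that \<open>u_lower\<close>, which is restricted to
    \<open>t \<le> 1\<close>, gives \<open>u t0 \<ge> 1/2\<close>.\<close>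
  define t0 where "t0 = min 1 (1 / (2 * K))"
  define \<kappa> where "\<kappa> = (\<sigma> + 1) / (q + 1) - (\<theta> + 1 - m) / m"
  define e0 where "e0 = c * \<kappa> * (1/2) powr (q + 1) * t0 powr (\<sigma> + 1) / (\<sigma> + 1)"
  define C1 where "C1 = 2 powr \<theta> * (\<sigma> + 1) / c"
  define C3 where "C3 = ((m - 1) / m * 2 powr (\<theta> * (m / (m - 1))) + c * C1 / (q + 1)) * C1 powr (m / (q - m + 1))"
  define \<nu> where "\<nu> = (\<theta> + 1 - m) - (\<sigma> + m - \<theta>) * (m / (q - m + 1))"
  have K: "0 < K" using assms by (simp add: K_def)
  then have t0: "0 < t0" by (simp add: t0_def)
  have "\<theta> + 1 - m < m * (\<sigma> + 1) / (q + 1)"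
    using assms by (subst pos_less_divide_eq) (auto simp: mult.commute)
  then have "(\<theta> + 1 - m) / m < m * (\<sigma> + 1) / (q + 1) / m"
    using assms by (intro divide_strict_right_mono) auto
  then have "0 < \<kappa>" using assms by (simp add: \<kappa>_def)
  then have e0: "0 < e0" unfolding e0_def using assms t0 by simp
  \<comment> \<open>The subcriticality hypothesis with \<open>m * (\<theta> + 1 - m)\<close>
    subtracted on both sides.\<close>
  have "(\<theta> + 1 - m) * (q - m + 1) < (\<sigma> + m - \<theta>) * m"
    using assms(5) by (simp add: algebra_simps)
  then have \<nu>: "\<nu> < 0" unfolding \<nu>_def using assms by (simp add: field_simps)
  have "((\<lambda>s. C3 * s powr \<nu>) \<longlongrightarrow> C3 * 0) at_top"
    by (intro tendsto_mult tendsto_const tendsto_neg_powr \<nu> filterlim_ident)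
  then have "\<forall>\<^sub>F s in at_top. C3 * s powr \<nu> < e0"
    using e0 by (intro order_tendstoD(2)) auto
  then have "\<forall>\<^sub>F s in at_top. C3 * s powr \<nu> < e0 \<and> t0 \<le> s"
    using eventually_ge_at_top by (intro eventually_conj)
  then obtain s where s: "C3 * s powr \<nu> < e0" "t0 \<le> s"
    using eventually_happens'[OF trivial_limit_at_top_linorder] by blast
  \<comment> \<open>The length \<open>2 * s + 1\<close> leaves room for the interval
    \<open>{s..2 * s}\<close> behind \<open>pohozaev_le\<close>.\<close>
  have "\<not> emden_solution m \<theta> \<sigma> q c (2 * s + 1) u P" for u P
  proof
    assume "emden_solution m \<theta> \<sigma> q c (2 * s + 1) u P"
    then interpret emden_solution m \<theta> \<sigma> q c "2 * s + 1" u P .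
    have "K * t0 \<le> K * (1 / (2 * K))" using K by (intro mult_left_mono) (auto simp: t0_def)
    then have "K * t0 \<le> 1/2" using K by simp
    moreover have "t0 \<le> 1" by (simp add: t0_def)
    ultimately have "1/2 \<le> u t0"
      using u_lower[of t0, folded K_def] t0 s by linarith
    moreover have "\<kappa> = gap" by (simp add: \<kappa>_def gap_def pohozaev_weight_def)
    ultimately have "e0 \<le> pohozaev t0"
      using pohozaev_ge[of t0] t0 s unfolding e0_def by auto
    also have "\<dots> \<le> pohozaev s" using t0 s by (intro pohozaev_mono) auto
    also have "\<dots> \<le> C3 * s powr \<nu>"
      using pohozaev_le[of s] t0 s unfolding C3_def \<nu>_def C1_def by auto
    finally show False using s by simp
  qed
  then show ?thesis using t0 s by (intro exI[of _ "2 * s + 1"]) auto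
qed

section \<open>Solutions without delay\<close>

lemma has_integral_scale:
  fixes f :: "real \<Rightarrow> real"
  assumes "(f has_integral i) {0..\<mu> * t}" "0 < \<mu>"
  shows "((\<lambda>\<tau>. f (\<mu> * \<tau>)) has_integral i / \<mu>) {0..t}"
proof -
  have "(\<lambda>x. x / \<mu>) ` {0..\<mu> * t} = {0..t}"
    using assms(2) by (auto simp: image_iff field_simps intro!: bexI[of _ "\<mu> * _"])
  then show ?thesis
    using has_integral_stretch_real[OF assms(1), of \<mu>] assms(2) by simp
qed

context radial begin

lemma slope_shift_0: "0 \<le> s \<Longrightarrow> slope A (shift 0 v) s = slope A v s"
  by (rule slope_cong) (auto simp: shift_def)

lemma picard_0: "picard A 0 d v t = d - integral {0..t} (slope A v)"
proof -
  have "integral {0..t} (slope A (shift 0 v)) = integral {0..t} (slope A v)"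
    by (rule Henstock_Kurzweil_Integration.integral_cong) (simp add: slope_shift_0)
  then show ?thesis by (simp add: picard_def)
qed

lemma solution_cong_coeff:
  assumes "delayed_solution A \<epsilon> d T v" "\<And>s x. 0 \<le> s \<Longrightarrow> A s x = A' s x"
  shows "delayed_solution A' \<epsilon> d T v"
proof -
  have "integral {0..t} (slope A (shift \<epsilon> v)) = integral {0..t} (slope A' (shift \<epsilon> v))" for t
    by (rule Henstock_Kurzweil_Integration.integral_cong) (simp add: slope_def assms(2))
  then show ?thesis using assms(1) by (simp add: delayed_solution_def picard_def)
qed

lemma solution_subinterval:
  "delayed_solution A \<epsilon> d T v \<Longrightarrow> T' \<le> T \<Longrightarrow> delayed_solution A \<epsilon> d T' v"
  by (auto simp: delayed_solution_def intro: continuous_on_subset)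

lemma solution_continuous: "delayed_solution A \<epsilon> d T v \<Longrightarrow> continuous_on {0..T} v"
  by (simp add: delayed_solution_def)

lemma solution_0: "delayed_solution A \<epsilon> d T v \<Longrightarrow> 0 \<le> T \<Longrightarrow> v 0 = d"
  by (simp add: delayed_solution_def picard_def)

lemma solution_has_derivative_within:
  assumes "admissible T A" "delayed_solution A 0 d T v" "t \<in> {0..T}"
  shows "(v has_real_derivative - slope A v t) (at t within {0..T})"
proof -
  have "(picard A 0 d v has_real_derivative - slope A v t) (at t within {0..T})"
    using picard_has_derivative[OF assms(1) solution_continuous[OF assms(2)] _ assms(3), of 0 d]
      slope_shift_0[of t A v] assms(3) by simp
  then show ?thesis
    by (rule has_field_derivative_transform_within[of _ _ _ _ 1])
       (use assms in \<open>auto simp: delayed_solution_def\<close>)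
qed

lemma solution_has_derivative:
  assumes "admissible T A" "delayed_solution A 0 d T v" "0 < t" "t < T"
  shows "(v has_real_derivative - slope A v t) (at t)"
  using solution_has_derivative_within[OF assms(1,2), of t] at_within_Icc_at[of 0 t T] assms by simp

text \<open>By continuity \<open>v \<ge> d / 2\<close> near 0, and the positive part in the
  integrand keeps the mass from decreasing later.\<close>

lemma solution_mass_pos:
  assumes "delayed_solution A \<epsilon> d T v" "0 < d" "0 < s" "s \<le> T"
  shows "0 < mass v s"
proof -
  have cont: "continuous_on {0..T} v" and v0: "v 0 = d"
    using assms solution_continuous solution_0 by auto
  obtain \<delta> where \<delta>: "0 < \<delta>" "\<And>x. x \<in> {0..T} \<Longrightarrow> dist x 0 < \<delta> \<Longrightarrow> dist (v x) (v 0) < d / 2"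
    using cont[unfolded continuous_on_iff, rule_format, of 0 "d / 2"] assms by auto
  define r where "r = min s (\<delta> / 2)"
  have r: "0 < r" "r \<le> s" "r < \<delta>" using assms \<delta> by (auto simp: r_def)
  have "d / 2 \<le> v \<tau>" if "\<tau> \<in> {0..r}" for \<tau>
  proof -
    have "\<bar>v \<tau> - d\<bar> < d / 2" using \<delta>(2)[of \<tau>] that r assms v0 by (simp add: dist_real_def)
    then show ?thesis by linarith
  qed
  then have "r powr (\<sigma> + 1) / (\<sigma> + 1) * (d / 2) powr p \<le> mass v r"
    by (intro mass_ge[OF cont]) (use r assms in auto)
  moreover have "0 < r powr (\<sigma> + 1) / (\<sigma> + 1) * (d / 2) powr p"
    using r assms sigma_gt_m1 by simp
  moreover have "mass v r \<le> mass v s" by (rule mass_mono[OF cont]) (use r assms in auto)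
  ultimately show ?thesis by linarith
qed

lemma solution_pos:
  assumes "admissible T A" "delayed_solution A 0 d T v" "0 < d" "0 \<le> v T" "0 \<le> t" "t < T"
    "\<And>s. 0 \<le> s \<Longrightarrow> 0 < A s (v s)"
  shows "0 < v t"
proof -
  have "v T < v t"
  proof (rule DERIV_neg_imp_decreasing_open[OF assms(6)])
    fix x assume x: "t < x" "x < T"
    have "0 < A x (v x)" by (rule assms) (use x assms(5) in simp)
    moreover have "0 < mass v x" by (rule solution_mass_pos[OF assms(2,3)]) (use x assms in auto)
    ultimately have "0 < A x (v x) * (x powr - \<theta> * mass v x)" using x assms(5) by simp
    then have "0 < slope A v x" unfolding slope_def by (subst powr_gt_zero) linarith
    then show "\<exists>y. (v has_real_derivative y) (at x) \<and> y < 0"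
      using solution_has_derivative[OF assms(1,2), of x] x assms by (auto intro!: exI)
  qed (use solution_continuous[OF assms(2)] assms in \<open>auto intro: continuous_on_subset\<close>)
  then show ?thesis using assms by simp
qed

text \<open>In terms of \<open>v powr \<delta>\<close> the degenerate factor \<open>v powr \<gamma>\<close> disappears from the equation. The estimate is
  stable under limits, so it keeps a blow-up limit from touching zero, where it would otherwise
  be allowed to vanish with zero slope.\<close>

lemma solution_decay:
  fixes \<gamma> C :: real
  defines "\<delta> \<equiv> 1 - \<gamma> / (m - 1)"
  assumes "admissible T A" "delayed_solution A 0 d T v" "0 < C" "0 < \<delta>"
    and lower: "\<And>s. s \<in> {0..T} \<Longrightarrow> 0 < v s \<Longrightarrow> C * v s powr \<gamma> \<le> A s (v s)"
    and pos: "\<And>s. 0 \<le> s \<Longrightarrow> s < T \<Longrightarrow> 0 < v s"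
    and st: "0 < s" "s < t" "t < T"
  shows "(t - s) * (\<delta> * (C * (t powr - \<theta> * mass v s)) powr (1 / (m - 1))) \<le> v s powr \<delta>"
proof -
  have cont: "continuous_on {0..T} v" by (rule solution_continuous) fact
  have "\<exists>z. z > s \<and> z < t \<and> v t powr \<delta> - v s powr \<delta> = (t - s) * (\<delta> * v z powr (\<delta> - 1) * - slope A v z)"
  proof (rule MVT2[OF st(2)])
    fix x assume x: "s \<le> x" "x \<le> t"
    have "(v has_real_derivative - slope A v x) (at x)"
      by (rule solution_has_derivative) (use assms x in auto)
    then show "((\<lambda>x. v x powr \<delta>) has_real_derivative \<delta> * v x powr (\<delta> - 1) * - slope A v x) (at x)"
      using pos[of x] x st by (auto intro!: derivative_eq_intros)
  qed
  then obtain z where z: "s < z" "z < t"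
    and eq: "v t powr \<delta> - v s powr \<delta> = (t - s) * (\<delta> * v z powr (\<delta> - 1) * - slope A v z)" by auto
  have vz: "0 < v z" using pos z st by simp
  \<comment> \<open>As \<open>s < z < t\<close>, this replaces the unknown mean value point by the
    endpoints.\<close>
  have "t powr - \<theta> * mass v s \<le> z powr - \<theta> * mass v z"
    using z st m_gt_1 theta_gt by (intro mult_mono powr_mono2' mass_mono[OF cont] mass_nonneg) auto
  then have "(C * v z powr \<gamma>) * (t powr - \<theta> * mass v s) \<le> A z (v z) * (z powr - \<theta> * mass v z)"
    using lower[of z] vz z st mass_nonneg[of s v] \<open>0 < C\<close> assms(2)
    by (intro mult_mono[of "C * v z powr \<gamma>"]) (auto simp: admissible_def)
  then have "((C * v z powr \<gamma>) * (t powr - \<theta> * mass v s)) powr (1 / (m - 1)) \<le> slope A v z"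
    unfolding slope_def using m_gt_1 \<open>0 < C\<close> mass_nonneg[of s v] st by (intro powr_mono2) auto
  also have "((C * v z powr \<gamma>) * (t powr - \<theta> * mass v s)) powr (1 / (m - 1)) =
     (v z powr \<gamma> * (C * (t powr - \<theta> * mass v s))) powr (1 / (m - 1))" by (simp add: mult_ac)
  also have "\<dots> = v z powr (\<gamma> / (m - 1)) * (C * (t powr - \<theta> * mass v s)) powr (1 / (m - 1))"
    using \<open>0 < C\<close> mass_nonneg[of s v] st by (simp add: powr_mult powr_powr)
  finally have "v z powr (\<delta> - 1) * (v z powr (\<gamma> / (m - 1)) * (C * (t powr - \<theta> * mass v s)) powr (1 / (m - 1)))
      \<le> v z powr (\<delta> - 1) * slope A v z" by (intro mult_left_mono) auto
  also have "v z powr (\<delta> - 1) * (v z powr (\<gamma> / (m - 1)) * (C * (t powr - \<theta> * mass v s)) powr (1 / (m - 1)))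
     = (v z powr (\<delta> - 1) * v z powr (\<gamma> / (m - 1))) * (C * (t powr - \<theta> * mass v s)) powr (1 / (m - 1))" by simp
  also have "v z powr (\<delta> - 1) * v z powr (\<gamma> / (m - 1)) = 1"
    using vz by (simp flip: powr_add add: \<delta>_def)
  finally have "(t - s) * (\<delta> * (C * (t powr - \<theta> * mass v s)) powr (1 / (m - 1)))
      \<le> (t - s) * (\<delta> * (v z powr (\<delta> - 1) * slope A v z))"
    using \<open>0 < \<delta>\<close> st by (intro mult_left_mono) auto
  moreover have "0 < v t powr \<delta>" using pos[of t] st by simp
  moreover have "v t powr \<delta> - v s powr \<delta> = - ((t - s) * (\<delta> * (v z powr (\<delta> - 1) * slope A v z)))"
    using eq by (simp add: mult_ac)
  ultimately show ?thesis by linarith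
qed

lemma admissible_powr: "0 < \<gamma> \<Longrightarrow> admissible T (\<lambda>s x. max 0 x powr \<gamma>)"
  unfolding admissible_def case_prod_unfold
  by (intro conjI allI continuous_on_powr' continuous_on_max continuous_on_const continuous_on_snd continuous_on_id) auto

text \<open>For positive \<open>w\<close> the pair \<open>w powr \<delta>\<close>,
  \<open>\<delta> powr (m - 1) * mass w\<close> solves the Emden--Fowler system with
  \<open>q = p / \<delta>\<close>; the constant \<open>c = \<delta> powr (m - 1)\<close> absorbs the
  factor \<delta> of the chain rule.\<close>

lemma limit_liouville:
  assumes "0 < \<gamma>" "\<gamma> < m - 1" "p > m - 1"
    "(p / (1 - \<gamma> / (m - 1)) + 1) * (\<theta> + 1 - m) < m * (\<sigma> + 1)"
  shows "\<exists>T>0. \<forall>w. delayed_solution (\<lambda>s x. max 0 x powr \<gamma>) 0 1 T w \<longrightarrow> (\<exists>t\<in>{0..T}. w t \<le> 0)"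
proof -
  define \<delta> where "\<delta> = 1 - \<gamma> / (m - 1)"
  define A where "A = (\<lambda>(s :: real) (x :: real). max 0 x powr \<gamma>)"
  have \<delta>: "0 < \<delta>" "\<delta> < 1" using assms by (auto simp: \<delta>_def)
  have q: "m - 1 < p / \<delta>"
  proof -
    have "p * \<delta> \<le> p * 1" using \<delta> p_pos by (intro mult_left_mono) auto
    then have "p \<le> p / \<delta>" using \<delta> by (simp add: field_simps)
    then show ?thesis using assms by simp
  qed
  obtain T where T: "T > 0" and no: "\<And>u P. \<not> emden_solution m \<theta> \<sigma> (p / \<delta>) (\<delta> powr (m - 1)) T u P"
    using emden_liouville[of m \<theta> \<sigma> "p / \<delta>" "\<delta> powr (m - 1)"] m_gt_1 theta_gt sigma_gt q assms(4) \<delta>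
    unfolding \<delta>_def[symmetric] by auto
  have "\<exists>t\<in>{0..T}. w t \<le> 0" if w: "delayed_solution A 0 1 T w" for w
  proof (rule ccontr)
    assume "\<not> (\<exists>t\<in>{0..T}. w t \<le> 0)"
    then have pos: "0 < w t" if "t \<in> {0..T}" for t using that by force
    have cont: "continuous_on {0..T} w" by (rule solution_continuous[OF w])
    have adm: "admissible T A" unfolding A_def by (rule admissible_powr) fact
    have "emden_solution m \<theta> \<sigma> (p / \<delta>) (\<delta> powr (m - 1)) T (\<lambda>t. w t powr \<delta>) (\<lambda>t. \<delta> powr (m - 1) * mass w t)"
    proof
      show "continuous_on {0..T} (\<lambda>t. w t powr \<delta>)"
        by (intro continuous_on_powr' cont continuous_on_const) (use less_imp_le[OF pos] \<delta> in auto)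
      show "continuous_on {0..T} (\<lambda>t. \<delta> powr (m - 1) * mass w t)"
        by (intro continuous_on_mult continuous_on_const continuous_on_mass cont)
      show "w 0 powr \<delta> = 1" using solution_0[OF w] T by simp
      fix t assume t: "0 < t" "t < T"
      then have wt: "0 < w t" using pos by simp
      show "0 < w t powr \<delta>" using wt by simp
      have d: "(w has_real_derivative - slope A w t) (at t)"
        by (rule solution_has_derivative[OF adm w t])
      have "((\<lambda>t. w t powr \<delta>) has_real_derivative \<delta> * w t powr (\<delta> - 1) * - slope A w t) (at t)"
        using wt d by (auto intro!: derivative_eq_intros)
      moreover have "\<delta> * w t powr (\<delta> - 1) * slope A w t
         = \<delta> * (w t powr (\<delta> - 1) * w t powr (\<gamma> / (m - 1))) * (t powr - \<theta> * mass w t) powr (1 / (m - 1))"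
        using wt mass_nonneg[of t w] t by (simp add: slope_def A_def powr_mult powr_powr)
      moreover have "w t powr (\<delta> - 1) * w t powr (\<gamma> / (m - 1)) = 1"
        using wt by (simp flip: powr_add add: \<delta>_def)
      moreover have "(t powr - \<theta> * (\<delta> powr (m - 1) * mass w t)) powr (1 / (m - 1)) =
         (\<delta> powr (m - 1) * (t powr - \<theta> * mass w t)) powr (1 / (m - 1))" by (simp add: mult_ac)
      moreover have "\<dots> = \<delta> * (t powr - \<theta> * mass w t) powr (1 / (m - 1))"
        using \<delta> m_gt_1 mass_nonneg[of t w] t by (simp add: powr_mult powr_powr)
      ultimately show "((\<lambda>t. w t powr \<delta>) has_real_derivative
          - ((t powr - \<theta> * (\<delta> powr (m - 1) * mass w t)) powr (1 / (m - 1)))) (at t)" by simp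
      have "((\<lambda>t. \<delta> powr (m - 1) * mass w t) has_real_derivative
          \<delta> powr (m - 1) * (t powr \<sigma> * max 0 (w t) powr p)) (at t)"
        by (intro DERIV_cmult mass_has_derivative[OF cont] t)
      moreover have "max 0 (w t) powr p = (w t powr \<delta>) powr (p / \<delta>)"
        using wt \<delta> by (simp add: powr_powr)
      ultimately show "((\<lambda>t. \<delta> powr (m - 1) * mass w t) has_real_derivative
          \<delta> powr (m - 1) * t powr \<sigma> * (w t powr \<delta>) powr (p / \<delta>)) (at t)" by (simp add: mult_ac)
    qed (use m_gt_1 theta_gt sigma_gt q assms(4) \<delta> T in \<open>auto simp flip: \<delta>_def\<close>)
    then show False using no by blast
  qed
  then show ?thesis using T unfolding A_def by blast
qed

text \<open>The mass picks up \<open>D powr - p * \<mu> powr - (\<sigma> + 1)\<close>, the weight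
  \<open>\<mu> powr \<theta>\<close> and the slope \<open>\<mu> / D\<close>; the factor in the new
  coefficient balances these powers.\<close>

lemma solution_scale:
  assumes "delayed_solution A 0 D R v" "0 < D" "0 < \<mu>" "\<mu> * T \<le> R" "0 \<le> T" "admissible R A"
  shows "delayed_solution (\<lambda>s x. A (\<mu> * s) (D * x) * (D powr (p - (m - 1)) * \<mu> powr (\<sigma> + m - \<theta>))) 0 1 T
    (\<lambda>t. v (\<mu> * t) / D)" (is "delayed_solution ?A 0 1 T ?w")
proof -
  have cont: "continuous_on {0..R} v" by (rule solution_continuous) fact
  have in_R: "\<mu> * t \<in> {0..R}" if "t \<in> {0..T}" for t
  proof -
    have "\<mu> * t \<le> \<mu> * T" using that assms(3) by (intro mult_left_mono) auto
    then have "\<mu> * t \<le> R" using assms(4) by linarith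
    then show ?thesis using that assms(3) by auto
  qed
  have mass: "mass ?w t = D powr - p * \<mu> powr - (\<sigma> + 1) * mass v (\<mu> * t)" if t: "t \<in> {0..T}" for t
  proof -
    let ?f = "\<lambda>\<tau>. \<tau> powr \<sigma> * max 0 (v \<tau>) powr p"
    have "(?f has_integral mass v (\<mu> * t)) {0..\<mu> * t}"
      unfolding mass_def using in_R[OF t] by (intro integrable_integral mass_integrable[OF cont]) auto
    from has_integral_scale[OF this assms(3)]
    have "((\<lambda>\<tau>. ?f (\<mu> * \<tau>)) has_integral mass v (\<mu> * t) / \<mu>) {0..t}" .
    from has_integral_mult_right[OF this, of "D powr - p * \<mu> powr - \<sigma>"]
    have "((\<lambda>\<tau>. D powr - p * \<mu> powr - \<sigma> * ?f (\<mu> * \<tau>)) has_integral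
       D powr - p * \<mu> powr - \<sigma> * (mass v (\<mu> * t) / \<mu>)) {0..t}" .
    moreover have "D powr - p * \<mu> powr - \<sigma> * ?f (\<mu> * \<tau>) = \<tau> powr \<sigma> * max 0 (?w \<tau>) powr p"
      if "\<tau> \<in> {0..t}" for \<tau>
    proof -
      have "max 0 (?w \<tau>) = max 0 (v (\<mu> * \<tau>)) / D"
        using assms(2) by (auto simp: max_def zero_le_divide_iff divide_le_0_iff)
      then show ?thesis unfolding \<open>max 0 (?w \<tau>) = _\<close>
        using assms(2,3) that by (simp add: powr_divide powr_mult powr_minus divide_simps)
    qed
    ultimately have "((\<lambda>\<tau>. \<tau> powr \<sigma> * max 0 (?w \<tau>) powr p) has_integral
       D powr - p * \<mu> powr - \<sigma> * (mass v (\<mu> * t) / \<mu>)) {0..t}"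
      by (rule has_integral_eq[rotated])
    then have "mass ?w t = D powr - p * \<mu> powr - \<sigma> * (mass v (\<mu> * t) / \<mu>)"
      unfolding mass_def[of ?w] by (rule integral_unique)
    also have "\<mu> powr - (\<sigma> + 1) = \<mu> powr - \<sigma> / \<mu>"
      using powr_diff[of \<mu> "- \<sigma>" 1] assms(3) by (simp only: minus_add_distrib add_uminus_conv_diff) simp
    then have "D powr - p * \<mu> powr - \<sigma> * (mass v (\<mu> * t) / \<mu>) = D powr - p * \<mu> powr - (\<sigma> + 1) * mass v (\<mu> * t)"
      by simp
    finally show ?thesis .
  qed
  have slope: "slope ?A ?w t = \<mu> / D * slope A v (\<mu> * t)" if t: "t \<in> {0..T}" for t
  proof -
    define X where "X = A (\<mu> * t) (v (\<mu> * t)) * ((\<mu> * t) powr - \<theta> * mass v (\<mu> * t))"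
    have X: "0 \<le> X" using assms(6) mass_nonneg[of "\<mu> * t" v] in_R[OF t] by (auto simp: X_def admissible_def)
    have "slope ?A ?w t = (A (\<mu> * t) (v (\<mu> * t)) * (D powr (p - (m - 1)) * \<mu> powr (\<sigma> + m - \<theta>)) *
       (t powr - \<theta> * (D powr - p * \<mu> powr - (\<sigma> + 1) * mass v (\<mu> * t)))) powr (1 / (m - 1))"
      unfolding slope_def mass[OF t] using assms(2) by simp
    also have "t powr - \<theta> = \<mu> powr \<theta> * (\<mu> * t) powr - \<theta>"
      using assms(3) t by (simp add: powr_mult powr_minus field_simps)
    also have "A (\<mu> * t) (v (\<mu> * t)) * (D powr (p - (m - 1)) * \<mu> powr (\<sigma> + m - \<theta>)) *
       (\<mu> powr \<theta> * (\<mu> * t) powr - \<theta> * (D powr - p * \<mu> powr - (\<sigma> + 1) * mass v (\<mu> * t))) =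
       (D powr (p - (m - 1)) * D powr - p) * (\<mu> powr (\<sigma> + m - \<theta>) * \<mu> powr \<theta> * \<mu> powr - (\<sigma> + 1)) * X"
      by (simp add: X_def mult_ac)
    also have "D powr (p - (m - 1)) * D powr - p = D powr - (m - 1)"
      by (simp flip: powr_add)
    also have "\<mu> powr (\<sigma> + m - \<theta>) * \<mu> powr \<theta> * \<mu> powr - (\<sigma> + 1) = \<mu> powr (m - 1)"
      by (simp flip: powr_add)
    also have "D powr - (m - 1) * \<mu> powr (m - 1) = (\<mu> / D) powr (m - 1)"
      using assms(2,3) powr_divide[of \<mu> D "m - 1"] unfolding powr_minus by (simp add: field_simps)
    also have "((\<mu> / D) powr (m - 1) * X) powr (1 / (m - 1)) = \<mu> / D * slope A v (\<mu> * t)"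
      using X m_gt_1 assms(2,3) by (simp add: powr_mult powr_powr X_def slope_def)
    finally show ?thesis .
  qed
  have "?w t = picard ?A 0 1 ?w t" if t: "t \<in> {0..T}" for t
  proof -
    have "(slope A v has_integral integral {0..\<mu> * t} (slope A v)) {0..\<mu> * t}"
      using in_R[OF t] admissible_slope[OF assms(6) cont]
      by (intro integrable_integral integrable_continuous_real) (auto intro: continuous_on_subset)
    from has_integral_mult_right[OF has_integral_scale[OF this assms(3)], of "\<mu> / D"]
    have "((\<lambda>\<tau>. \<mu> / D * slope A v (\<mu> * \<tau>)) has_integral integral {0..\<mu> * t} (slope A v) / D) {0..t}"
      using assms(3) by simp
    then have "(slope ?A ?w has_integral integral {0..\<mu> * t} (slope A v) / D) {0..t}"
      by (rule has_integral_eq[rotated]) (use slope t in auto)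
    then have "picard ?A 0 1 ?w t = 1 - integral {0..\<mu> * t} (slope A v) / D"
      unfolding picard_0 by (simp add: integral_unique)
    also have "\<dots> = picard A 0 D v (\<mu> * t) / D" unfolding picard_0 using assms(2) by (simp add: field_simps)
    also have "\<dots> = ?w t" using assms(1) in_R[OF t] by (simp add: delayed_solution_def)
    finally show ?thesis by simp
  qed
  moreover have "continuous_on {0..T} ?w"
    by (intro continuous_on_divide continuous_on_const continuous_on_compose2[OF cont])
       (use in_R assms(2) in \<open>auto intro!: continuous_intros\<close>)
  ultimately show ?thesis by (simp add: delayed_solution_def)
qed

end

section \<open>Blow-up and shooting\<close>

text \<open>Here \<open>subcritical\<close> is the Liouville condition for the exponent
  \<open>p / \<delta>\<close>; the final theorem derives it from the upper bound on \<open>p\<close>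
  in (H1).\<close>

locale quasilinear = radial +
  fixes \<gamma> c1 c2 :: real and a g :: "real \<Rightarrow> real"
  assumes gamma: "0 < \<gamma>" "\<gamma> < m - 1" and superlinear: "p > m - 1"
    and subcritical: "(p / (1 - \<gamma> / (m - 1)) + 1) * (\<theta> + 1 - m) < m * (\<sigma> + 1)"
    and g_cont: "continuous_on {0..} g" and g_nonneg: "\<And>v. 0 \<le> v \<Longrightarrow> 0 \<le> g v"
    and g_mono: "mono_on {0..} g" and g_lim: "((\<lambda>v. g v / v) \<longlongrightarrow> 1) at_top"
    and a_cont: "continuous_on {0..} a" and c1: "0 < c1"
    and a_bounds: "\<And>t. 0 \<le> t \<Longrightarrow> c1 \<le> a t \<and> a t \<le> c2"
begin

text \<open>\<open>coeff 1 1\<close> is the original coefficient; \<open>coeff \<mu> D\<close> is that of the equation for \<open>v (\<mu> * t) / D\<close>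
  when \<open>\<mu> powr (\<sigma> + m - \<theta>) = D powr - (p + \<gamma> - (m - 1))\<close>.\<close>

definition coeff :: "real \<Rightarrow> real \<Rightarrow> real \<Rightarrow> real \<Rightarrow> real" where
  "coeff \<mu> D s x = ((a (\<mu> * s) + g (D * max 0 x)) / D) powr \<gamma>"

lemma admissible_coeff:
  assumes "0 \<le> \<mu>" "0 < D"
  shows "admissible T (coeff \<mu> D)"
proof -
  have "continuous_on ({0..T} \<times> UNIV) (\<lambda>z :: real \<times> real. a (\<mu> * fst z))"
    by (rule continuous_on_compose2[OF a_cont])
       (use assms in \<open>auto intro!: continuous_on_mult continuous_on_const continuous_on_fst continuous_on_id\<close>)
  moreover have "continuous_on ({0..T} \<times> UNIV) (\<lambda>z :: real \<times> real. g (D * max 0 (snd z)))"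
    by (rule continuous_on_compose2[OF g_cont])
       (use assms in \<open>auto intro!: continuous_on_mult continuous_on_max continuous_on_const continuous_on_snd continuous_on_id\<close>)
  moreover have "0 < (a (\<mu> * s) + g (D * max 0 y)) / D" if "0 \<le> s" for s y
    using assms a_bounds[of "\<mu> * s"] g_nonneg[of "D * max 0 y"] c1 that by (simp add: add_pos_nonneg)
  then have "0 \<le> (a (\<mu> * s) + g (D * max 0 y)) / D" if "0 \<le> s" for s y
    using that by (simp add: less_imp_le)
  ultimately have "continuous_on ({0..T} \<times> UNIV) (\<lambda>z. coeff \<mu> D (fst z) (snd z))"
    unfolding coeff_def
    by (intro continuous_on_powr' continuous_on_divide continuous_on_add continuous_on_const)
       (use assms gamma in \<open>auto simp del: divide_nonneg_pos zero_le_divide_iff\<close>)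
  then show ?thesis by (simp add: admissible_def case_prod_unfold coeff_def)
qed

section \<open>Uniform bounds and limit of the rescaled coefficient\<close>

lemma coeff_pos: "0 < coeff \<mu> D s x" if "0 \<le> \<mu>" "0 < D" "0 \<le> s"
  using that a_bounds[of "\<mu> * s"] g_nonneg[of "D * max 0 x"] c1
  by (simp add: coeff_def add_pos_nonneg order_less_imp_not_eq2)

text \<open>From some \<open>V\<close> on, the limit gives \<open>g v < 2 * v\<close>; below
  \<open>V\<close> monotonicity bounds \<open>g v\<close> by \<open>g V\<close>.\<close>

lemma g_upper: obtains G where "0 \<le> G" "\<And>v. 0 \<le> v \<Longrightarrow> g v \<le> 2 * v + G"
proof -
  have "\<forall>\<^sub>F v in at_top. g v / v < 2 \<and> 0 < v"
    using g_lim by (intro eventually_conj order_tendstoD(2) eventually_gt_at_top) auto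
  then obtain V where V: "\<And>v. V \<le> v \<Longrightarrow> g v / v < 2 \<and> 0 < v"
    unfolding eventually_at_top_linorder by blast
  have V0: "0 < V" using V by blast
  have "g v \<le> 2 * v + g V" if "0 \<le> v" for v
  proof (cases "V \<le> v")
    case True
    then have "g v \<le> 2 * v" using V[OF True] pos_divide_less_eq[of v "g v" 2] by simp
    then show ?thesis using g_nonneg[of V] V0 by simp
  next
    case False
    then have "g v \<le> g V" using g_mono that V0 by (auto intro: mono_onD)
    then show ?thesis using that by simp
  qed
  then show thesis using that g_nonneg[of V] V0 by simp
qed

text \<open>The constant is independent of the scaling: for large \<open>v\<close> the growth of
  \<open>g\<close> gives \<open>g v \<ge> v / 2\<close>, and for the remaining \<open>v\<close> the
  lower bound \<open>c1\<close> takes over. This supplies \<open>lower\<close> in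
  \<open>solution_decay\<close>.\<close>

lemma coeff_lower: obtains C where "0 < C"
  "\<And>\<mu> D s x. 0 \<le> \<mu> \<Longrightarrow> 0 < D \<Longrightarrow> 0 \<le> s \<Longrightarrow> 0 < x \<Longrightarrow> C * x powr \<gamma> \<le> coeff \<mu> D s x"
proof -
  have "\<forall>\<^sub>F v in at_top. 1/2 < g v / v \<and> 0 < v"
    using g_lim by (intro eventually_conj order_tendstoD(1) eventually_gt_at_top) auto
  then obtain V where V: "\<And>v. V \<le> v \<Longrightarrow> 1/2 < g v / v \<and> 0 < v"
    unfolding eventually_at_top_linorder by blast
  have V0: "0 < V" using V by blast
  define k where "k = min (1/2) (c1 / V)"
  have k: "0 < k" using c1 V0 by (simp add: k_def)
  have low: "k * v \<le> c1 + g v" if "0 \<le> v" for v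
  proof (cases "V \<le> v")
    case True
    have "k \<le> 1/2" unfolding k_def by (rule min.cobounded1)
    then have "k * v \<le> 1/2 * v" using that by (intro mult_right_mono) auto
    also have "\<dots> \<le> g v" using V[OF True] pos_less_divide_eq[of v "1/2" "g v"] by simp
    finally show ?thesis using c1 by simp
  next
    case False
    have "k * v \<le> c1 / V * V" using that False c1 V0 by (intro mult_mono) (auto simp: k_def)
    then show ?thesis using V0 g_nonneg[OF that] by simp
  qed
  have "k powr \<gamma> * x powr \<gamma> \<le> coeff \<mu> D s x" if "0 \<le> \<mu>" "0 < D" "0 \<le> s" "0 < x" for \<mu> D s x
  proof -
    have "k * (D * x) \<le> a (\<mu> * s) + g (D * x)"
      using low[of "D * x"] a_bounds[of "\<mu> * s"] that by auto
    then have "k * x \<le> (a (\<mu> * s) + g (D * x)) / D"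
      using that by (simp add: field_simps)
    then have "(k * x) powr \<gamma> \<le> coeff \<mu> D s x"
      unfolding coeff_def using that k gamma by (simp add: powr_mono2)
    then show ?thesis using that k by (simp add: powr_mult)
  qed
  then show thesis using that k by (metis powr_gt_zero less_irrefl)
qed

text \<open>For \<open>D \<ge> 1\<close>, dividing by \<open>D\<close> cannot enlarge
  \<open>c2 + G\<close>, so one \<open>B\<close> serves all scales.\<close>

lemma coeff_upper: obtains B where "0 \<le> B"
  "\<And>\<mu> D s x M. 0 \<le> \<mu> \<Longrightarrow> 1 \<le> D \<Longrightarrow> 0 \<le> s \<Longrightarrow> x \<le> M \<Longrightarrow> 0 \<le> M \<Longrightarrow> coeff \<mu> D s x \<le> (2 * M + B) powr \<gamma>"
proof -
  obtain G where G: "0 \<le> G" "\<And>v. 0 \<le> v \<Longrightarrow> g v \<le> 2 * v + G" by (rule g_upper) blast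
  have c2: "0 \<le> c2" using a_bounds[of 0] c1 by simp
  have "coeff \<mu> D s x \<le> (2 * M + (c2 + G)) powr \<gamma>"
    if "0 \<le> \<mu>" "1 \<le> D" "0 \<le> s" "x \<le> M" "0 \<le> M" for \<mu> D s x M
  proof -
    have "a (\<mu> * s) + g (D * max 0 x) \<le> c2 + (2 * (D * max 0 x) + G)"
      by (intro add_mono G(2)) (use a_bounds[of "\<mu> * s"] that in auto)
    also have "D * max 0 x \<le> D * M" using that by (intro mult_left_mono) auto
    also have "c2 + (2 * (D * M) + G) \<le> D * c2 + (2 * (D * M) + D * G)"
      using that G(1) c2 mult_right_mono[of 1 D c2] mult_right_mono[of 1 D G] by auto
    finally have "a (\<mu> * s) + g (D * max 0 x) \<le> D * (2 * M + (c2 + G))" by (simp add: algebra_simps)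
    then have "(a (\<mu> * s) + g (D * max 0 x)) / D \<le> 2 * M + (c2 + G)" using that by (simp add: field_simps)
    moreover have "0 \<le> (a (\<mu> * s) + g (D * max 0 x)) / D"
      using that a_bounds[of "\<mu> * s"] g_nonneg[of "D * max 0 x"] c1 by auto
    ultimately show ?thesis unfolding coeff_def using gamma by (intro powr_mono2) auto
  qed
  from that[OF add_nonneg_nonneg[OF c2 G(1)] this] show thesis by blast
qed

text \<open>If \<open>y > 0\<close>, the argument of \<open>g\<close> tends to infinity, where
  \<open>g v / v\<close> tends to 1; otherwise the positive parts tend to 0 and the linear bound on
  \<open>g\<close> suffices. The bounded \<open>a\<close> is divided away.\<close>

lemma coeff_tendsto:
  assumes "\<And>k. 0 \<le> \<mu> k" "\<And>k. 0 < D k" "filterlim D at_top sequentially" "0 \<le> s" "x \<longlonglongrightarrow> y"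
  shows "(\<lambda>k. coeff (\<mu> k) (D k) s (x k)) \<longlonglongrightarrow> max 0 y powr \<gamma>"
proof -
  define z where "z k = max 0 (x k)" for k
  have z: "z \<longlonglongrightarrow> max 0 y" "\<And>k. 0 \<le> z k"
    unfolding z_def using assms(5) by (auto intro: tendsto_max)
  have invD: "(\<lambda>k. c / D k) \<longlonglongrightarrow> 0" for c
    by (intro tendsto_divide_0[OF tendsto_const] filterlim_at_top_imp_at_infinity assms(3))
  have glim: "(\<lambda>k. g (D k * z k) / D k) \<longlonglongrightarrow> max 0 y"
  proof (cases "0 < y")
    case True
    have Dz: "filterlim (\<lambda>k. z k * D k) at_top sequentially"
      by (rule filterlim_tendsto_pos_mult_at_top[OF z(1) _ assms(3)]) (use True in auto)
    then have "(\<lambda>k. g (z k * D k) / (z k * D k) * z k) \<longlonglongrightarrow> 1 * max 0 y"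
      by (intro tendsto_mult z(1) filterlim_compose[OF g_lim])
    moreover have "\<forall>\<^sub>F k in sequentially. 0 < z k"
      using z(1) True by (intro order_tendstoD(1)) auto
    then have "\<forall>\<^sub>F k in sequentially. g (z k * D k) / (z k * D k) * z k = g (D k * z k) / D k"
      by eventually_elim (simp add: mult.commute)
    ultimately show ?thesis by (simp add: tendsto_cong)
  next
    case False
    obtain G where G: "0 \<le> G" "\<And>v. 0 \<le> v \<Longrightarrow> g v \<le> 2 * v + G" by (rule g_upper) blast
    have "(\<lambda>k. g (D k * z k) / D k) \<longlonglongrightarrow> 0"
    proof (rule tendsto_sandwich[of "\<lambda>_. 0"])
      have "g (D k * z k) / D k \<le> 2 * z k + G / D k" for k
        using G(2)[of "D k * z k"] z(2)[of k] assms(2)[of k] by (simp add: field_simps)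
      then show "\<forall>\<^sub>F k in sequentially. g (D k * z k) / D k \<le> 2 * z k + G / D k" by simp
      show "\<forall>\<^sub>F k in sequentially. 0 \<le> g (D k * z k) / D k"
        by (intro always_eventually allI divide_nonneg_pos g_nonneg mult_nonneg_nonneg z(2) less_imp_le[OF assms(2)] assms(2))
      have "(\<lambda>k. 2 * z k + G / D k) \<longlonglongrightarrow> 2 * max 0 y + 0" by (intro tendsto_intros z invD)
      then show "(\<lambda>k. 2 * z k + G / D k) \<longlonglongrightarrow> 0" using False by simp
    qed auto
    then show ?thesis using False by simp
  qed
  have "(\<lambda>k. a (\<mu> k * s) / D k) \<longlonglongrightarrow> 0"
  proof (rule tendsto_sandwich[OF _ _ tendsto_const invD[of c2]])
    have "0 \<le> a (\<mu> k * s)" for k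
      using a_bounds[of "\<mu> k * s"] assms(1)[of k] assms(4) c1 by simp
    then show "\<forall>\<^sub>F k in sequentially. 0 \<le> a (\<mu> k * s) / D k"
      by (intro always_eventually allI divide_nonneg_pos assms(2))
    show "\<forall>\<^sub>F k in sequentially. a (\<mu> k * s) / D k \<le> c2 / D k"
      using a_bounds assms by (intro always_eventually allI divide_right_mono) (auto simp: less_imp_le)
  qed
  from tendsto_add[OF this glim]
  have "(\<lambda>k. (a (\<mu> k * s) + g (D k * z k)) / D k) \<longlonglongrightarrow> max 0 y" by (simp add: add_divide_distrib)
  moreover have "0 \<le> (a (\<mu> k * s) + g (D k * z k)) / D k" for k
    using a_bounds[of "\<mu> k * s"] g_nonneg[of "D k * z k"] c1 assms(1,2,4) z(2)[of k]
    by (intro divide_nonneg_pos add_nonneg_nonneg) (auto simp: less_imp_le)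
  ultimately show ?thesis
    unfolding coeff_def z_def[symmetric] using gamma by (intro tendsto_powr' tendsto_const) auto
qed

text \<open>Negativity at \<open>R\<close> is claimed for every solution with this initial value, as
  there may be several.\<close>

lemma blow_up:
  assumes "0 < R"
  shows "\<exists>D\<ge>1. \<forall>v. delayed_solution (coeff 1 1) 0 D R v \<longrightarrow> v R < 0"
proof (rule ccontr)
  assume "\<not> ?thesis"
  then have "\<exists>v. delayed_solution (coeff 1 1) 0 D R v \<and> 0 \<le> v R" if "1 \<le> D" for D
    using that by (meson not_less)
  then obtain V where V: "\<And>D. 1 \<le> D \<Longrightarrow> delayed_solution (coeff 1 1) 0 D R (V D) \<and> 0 \<le> V D R"
    by metis
  define A where "A = (\<lambda>(s :: real) (x :: real). max 0 x powr \<gamma>)"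
  obtain T where T: "0 < T" and liouville: "\<And>w. delayed_solution A 0 1 T w \<Longrightarrow> \<exists>t\<in>{0..T}. w t \<le> 0"
    using limit_liouville[OF gamma superlinear subcritical] unfolding A_def by blast
  \<comment> \<open>The exponent for which \<open>\<mu> = D powr e\<close> makes the factor in
    \<open>solution_scale\<close> equal to \<open>D powr - \<gamma>\<close>, so that the scaled
    coefficient is \<open>coeff \<mu> D\<close>.\<close>
  define e where "e = - ((p + \<gamma> - (m - 1)) / (\<sigma> + m - \<theta>))"
  have den: "0 < \<sigma> + m - \<theta>" using sigma_gt m_gt_1 by simp
  then have e: "e < 0" using superlinear gamma by (simp add: e_def)
  \<comment> \<open>Since \<open>e < 0\<close>, for large \<open>D\<close> the rescaled solutions
    live on \<open>{0..T + 1}\<close>. The extra unit leaves room to the right of \<open>T\<close>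
    for \<open>solution_decay\<close>.\<close>
  have "((\<lambda>D. (T + 1) * D powr e) \<longlongrightarrow> (T + 1) * 0) at_top"
    by (intro tendsto_mult tendsto_const tendsto_neg_powr e filterlim_ident)
  then have "\<forall>\<^sub>F D in at_top. (T + 1) * D powr e < R"
    using assms by (intro order_tendstoD(2)) auto
  then obtain D0 where D0: "\<And>D. D0 \<le> D \<Longrightarrow> (T + 1) * D powr e < R"
    unfolding eventually_at_top_linorder by blast
  define D where "D k = max D0 1 + real k" for k
  define \<mu> where "\<mu> k = D k powr e" for k
  have D: "1 \<le> D k" for k by (simp add: D_def)
  have \<mu>: "0 < \<mu> k" "\<mu> k * (T + 1) \<le> R" for k
  proof -
    have "D0 \<le> D k" by (simp add: D_def)
    from D0[OF this] show "\<mu> k * (T + 1) \<le> R" by (simp add: \<mu>_def mult.commute)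
    show "0 < \<mu> k" using D[of k] by (simp add: \<mu>_def)
  qed
  have Dlim: "filterlim D at_top sequentially"
    unfolding D_def by (rule filterlim_tendsto_add_at_top[OF tendsto_const filterlim_real_sequentially])
  define w where "w k t = V (D k) (\<mu> k * t) / D k" for k t
  have scale: "D k powr (p - (m - 1)) * \<mu> k powr (\<sigma> + m - \<theta>) = D k powr - \<gamma>" for k
    unfolding \<mu>_def e_def using D[of k] den by (simp add: powr_powr flip: powr_add)
  have sol: "delayed_solution (coeff (\<mu> k) (D k)) 0 1 (T + 1) (w k)" for k
  proof -
    have "delayed_solution (\<lambda>s x. coeff 1 1 (\<mu> k * s) (D k * x) *
        (D k powr (p - (m - 1)) * \<mu> k powr (\<sigma> + m - \<theta>))) 0 1 (T + 1) (w k)"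
      unfolding w_def by (rule solution_scale[where R = R])
        (use V[of "D k"] D[of k] \<mu>[of k] T in \<open>auto intro: admissible_coeff\<close>)
    moreover have "coeff 1 1 (\<mu> k * s) (D k * x) * D k powr - \<gamma> = coeff (\<mu> k) (D k) s x" if "0 \<le> s" for s x
    proof -
      have "0 \<le> a (\<mu> k * s) + g (D k * max 0 x)"
        using a_bounds[of "\<mu> k * s"] g_nonneg[of "D k * max 0 x"] c1 \<mu>(1)[of k] D[of k] that by auto
      moreover have "max 0 (D k * x) = D k * max 0 x"
        using D[of k] by (auto simp: max_def zero_le_mult_iff mult_le_0_iff)
      ultimately show ?thesis using D[of k] by (simp add: coeff_def powr_divide powr_minus field_simps)
    qed
    ultimately show ?thesis
      unfolding scale by (rule solution_cong_coeff)
  qed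
  have adm: "admissible T' (coeff (\<mu> k) (D k))" for k T'
    using \<mu>(1)[of k] D[of k] by (intro admissible_coeff) auto
  have wpos: "0 < w k t" if "0 \<le> t" "t < T + 1" for k t
  proof -
    have "\<mu> k * t < \<mu> k * (T + 1)" using that \<mu>(1)[of k] by (intro mult_strict_left_mono) auto
    then have "\<mu> k * t < R" using \<mu>(2)[of k] by linarith
    moreover have "admissible R (coeff 1 1)" by (rule admissible_coeff) auto
    ultimately have "0 < V (D k) (\<mu> k * t)"
      using V[OF D, of k] D[of k] \<mu>(1)[of k] that coeff_pos[of 1 1]
      by - (rule solution_pos[of R "coeff 1 1" "D k"], auto)
    then show ?thesis using D[of k] by (simp add: w_def)
  qed
  obtain B where B: "0 \<le> B" "\<And>\<mu> D s x M. 0 \<le> \<mu> \<Longrightarrow> 1 \<le> D \<Longrightarrow> 0 \<le> s \<Longrightarrow> x \<le> M \<Longrightarrow> 0 \<le> M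
      \<Longrightarrow> coeff \<mu> D s x \<le> (2 * M + B) powr \<gamma>"
    by (rule coeff_upper) blast
  obtain u h where u: "delayed_solution A 0 1 (T + 1) u" and h: "strict_mono (h :: nat \<Rightarrow> nat)"
    and conv: "\<And>s. s \<in> {0..T + 1} \<Longrightarrow> (\<lambda>k. w (h k) s) \<longlonglongrightarrow> u s"
    and mconv: "\<And>s. s \<in> {0..T + 1} \<Longrightarrow> (\<lambda>k. mass (w (h k)) s) \<longlonglongrightarrow> mass u s"
  proof (rule solution_compactness[of "T + 1" "\<lambda>k. coeff (\<mu> k) (D k)" "\<lambda>_. 0" "\<lambda>_. 1" w 1 1 "(2 * 1 + B) powr \<gamma>" A])
    show "coeff (\<mu> k) (D k) s z \<le> (2 * 1 + B) powr \<gamma>" if "s \<in> {0..T + 1}" "z \<le> 1" for k s z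
      using B(2)[of "\<mu> k" "D k" s z 1] \<mu>(1)[of k] D[of k] that by auto
    show "(\<lambda>k. coeff (\<mu> k) (D k) s (x k)) \<longlonglongrightarrow> A s y" if "s \<in> {0..T + 1}" "x \<longlonglongrightarrow> y" for s x y
      unfolding A_def using that \<mu>(1) D
      by (intro coeff_tendsto Dlim) (auto simp: less_imp_le intro: less_le_trans[OF zero_less_one])
  qed (use adm sol T in auto)
  obtain C where C: "0 < C" and lower:
    "\<And>\<mu> D s x. 0 \<le> \<mu> \<Longrightarrow> 0 < D \<Longrightarrow> 0 \<le> s \<Longrightarrow> 0 < x \<Longrightarrow> C * x powr \<gamma> \<le> coeff \<mu> D s x"
    by (rule coeff_lower) blast
  define \<delta> where "\<delta> = 1 - \<gamma> / (m - 1)"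
  have \<delta>: "0 < \<delta>" using gamma by (simp add: \<delta>_def)
  have "0 < u s" if s: "s \<in> {0..T}" for s
  proof (cases "s = 0")
    case True
    then show ?thesis using solution_0[OF u] T by simp
  next
    case False
    \<comment> \<open>The decay estimate at \<open>s\<close> uses positivity of the rescaled
      solutions beyond \<open>s\<close>, also when \<open>s = T\<close>.\<close>
    define t where "t = T + 1/2"
    let ?b = "\<lambda>M. (t - s) * (\<delta> * (C * (t powr - \<theta> * M)) powr (1 / (m - 1)))"
    have st: "0 < s" "s < t" "t < T + 1" using s False by (auto simp: t_def)
    have "?b (mass (w (h k)) s) \<le> w (h k) s powr \<delta>" for k
      unfolding \<delta>_def
    proof (rule solution_decay[OF adm sol C])
      show "0 < 1 - \<gamma> / (m - 1)" using \<delta> by (simp add: \<delta>_def)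
      show "C * w (h k) r powr \<gamma> \<le> coeff (\<mu> (h k)) (D (h k)) r (w (h k) r)"
        if "r \<in> {0..T + 1}" "0 < w (h k) r" for r
        using lower[of "\<mu> (h k)" "D (h k)" r] \<mu>(1)[of "h k"] D[of "h k"] that by auto
    qed (use wpos st in auto)
    moreover have "(\<lambda>k. ?b (mass (w (h k)) s)) \<longlonglongrightarrow> ?b (mass u s)"
      using s st mass_nonneg[of s] C m_gt_1
      by (intro tendsto_mult tendsto_const tendsto_powr' mconv) auto
    moreover have "(\<lambda>k. w (h k) s powr \<delta>) \<longlonglongrightarrow> u s powr \<delta>"
      using s \<delta> wpos[of s] T
      by (intro tendsto_powr' tendsto_const conv) (auto simp: less_imp_le)
    ultimately have "?b (mass u s) \<le> u s powr \<delta>"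
      by (intro LIMSEQ_le[of _ "?b (mass u s)" _ "u s powr \<delta>"]) auto
    \<comment> \<open>The limit starts at 1, so its mass is positive, and the limiting estimate
      excludes \<open>u s = 0\<close>.\<close>
    moreover have "0 < mass u s" by (rule solution_mass_pos[OF u]) (use s st in auto)
    then have "0 < C * (t powr - \<theta> * mass u s)" using C st by simp
    then have "0 < (C * (t powr - \<theta> * mass u s)) powr (1 / (m - 1))" by (subst powr_gt_zero) linarith
    then have "0 < ?b (mass u s)" using \<delta> st by simp
    ultimately have "u s \<noteq> 0" by auto
    moreover have "0 \<le> u s"
      by (rule LIMSEQ_le_const[OF conv]) (use s wpos in \<open>auto simp: less_imp_le\<close>)
    ultimately show ?thesis by simp
  qed
  moreover have "delayed_solution A 0 1 T u" by (rule solution_subinterval[OF u]) simp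
  ultimately show False using liouville by force
qed

text \<open>The drop from the initial value \<open>d\<close> is at most
  \<open>R * L * d powr (p / (m - 1))\<close>, which is less than \<open>d\<close> for suitably
  small \<open>d\<close> as \<open>p > m - 1\<close>. The bound does not depend on the
  delay.\<close>

lemma small_data:
  assumes "0 < R"
  shows "\<exists>d0>0. d0 \<le> 1 \<and> (\<forall>\<epsilon>\<ge>0. \<forall>v. delayed_solution (coeff 1 1) \<epsilon> d0 R v \<longrightarrow> 0 < v R)"
proof -
  obtain B where B: "0 \<le> B" "\<And>\<mu> D s x M. 0 \<le> \<mu> \<Longrightarrow> 1 \<le> D \<Longrightarrow> 0 \<le> s \<Longrightarrow> x \<le> M \<Longrightarrow> 0 \<le> M
      \<Longrightarrow> coeff \<mu> D s x \<le> (2 * M + B) powr \<gamma>"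
    by (rule coeff_upper) blast
  define L where "L = slope_cap R 1 ((2 + B) powr \<gamma>)"
  have e: "0 < p / (m - 1) - 1" using superlinear m_gt_1 by simp
  have cap: "slope_cap R d ((2 + B) powr \<gamma>) = L * d powr (p / (m - 1))" if "0 < d" for d
  proof -
    have "slope_cap R d ((2 + B) powr \<gamma>) =
        (((2 + B) powr \<gamma> * (R powr (\<sigma> + 1 - \<theta>) / (\<sigma> + 1))) * d powr p) powr (1 / (m - 1))"
      by (simp add: slope_cap_def mult.assoc)
    also have "\<dots> = L * d powr (p / (m - 1))"
      using that sigma_gt_m1 by (subst powr_mult) (auto simp: powr_powr L_def slope_cap_def)
    finally show ?thesis .
  qed
  have "((\<lambda>d. R * L * d powr (p / (m - 1) - 1)) \<longlongrightarrow> R * L * 0 powr (p / (m - 1) - 1)) (at_right 0)"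
    by (intro tendsto_mult tendsto_const tendsto_powr' tendsto_ident_at disjI2)
       (use e in \<open>auto simp: eventually_at_filter\<close>)
  then have "\<forall>\<^sub>F d in at_right 0. R * L * d powr (p / (m - 1) - 1) < 1"
    by (intro order_tendstoD(2)) auto
  moreover have "\<forall>\<^sub>F d in at_right 0. d \<in> {0<..<1 :: real}" by (rule eventually_at_right_real) simp
  ultimately have "\<forall>\<^sub>F d in at_right 0. R * L * d powr (p / (m - 1) - 1) < 1 \<and> d \<in> {0<..<1 :: real}"
    by (rule eventually_conj)
  from eventually_happens'[OF trivial_limit_at_right_real this]
  obtain d where d: "0 < d" "d < 1" "R * L * d powr (p / (m - 1) - 1) < 1" by auto
  have "R * L * d powr (p / (m - 1) - 1) * d < 1 * d" using d by (intro mult_strict_right_mono) auto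
  moreover have "d powr (p / (m - 1) - 1) * d = d powr (p / (m - 1))" using d by (simp add: powr_diff)
  ultimately have small: "R * (L * d powr (p / (m - 1))) < d" by (simp add: mult.assoc)
  have "0 < v R" if "0 \<le> \<epsilon>" and v: "delayed_solution (coeff 1 1) \<epsilon> d R v" for \<epsilon> v
  proof -
    have "\<bar>v R - v 0\<bar> \<le> slope_cap R d ((2 + B) powr \<gamma>) * \<bar>R - 0\<bar>"
    proof (rule delayed_solution_lipschitz[OF _ v that(1)])
      show "coeff 1 1 s z \<le> (2 + B) powr \<gamma>" if "s \<in> {0..R}" "z \<le> d" for s z
        using B(2)[of 1 1 s z 1] that d by auto
    qed (use d assms admissible_coeff in auto)
    then have "\<bar>v R - d\<bar> \<le> R * (L * d powr (p / (m - 1)))"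
      using solution_0[OF v] assms cap[OF d(1)] by (simp add: mult.commute)
    then show ?thesis using small by linarith
  qed
  then show ?thesis using d by (intro exI[of _ d]) auto
qed

text \<open>For each delay the value at \<open>R\<close> depends continuously on \<open>d\<close>,
  which allows the intermediate value theorem on \<open>{d0..D}\<close>; compactness then removes
  the delay.\<close>

lemma boundary_solution:
  assumes "0 < R"
  obtains d v where "0 < d" "delayed_solution (coeff 1 1) 0 d R v" "v R = 0"
proof -
  let ?A = "coeff 1 1"
  obtain D where D: "1 \<le> D" "\<And>v. delayed_solution ?A 0 D R v \<Longrightarrow> v R < 0"
    using blow_up[OF assms] by blast
  obtain d0 where d0: "0 < d0" "d0 \<le> 1"
    "\<And>\<epsilon> v. 0 \<le> \<epsilon> \<Longrightarrow> delayed_solution ?A \<epsilon> d0 R v \<Longrightarrow> 0 < v R"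
    using small_data[OF assms] by blast
  obtain B where B: "0 \<le> B" "\<And>\<mu> D s x M. 0 \<le> \<mu> \<Longrightarrow> 1 \<le> D \<Longrightarrow> 0 \<le> s \<Longrightarrow> x \<le> M \<Longrightarrow> 0 \<le> M
      \<Longrightarrow> coeff \<mu> D s x \<le> (2 * M + B) powr \<gamma>"
    by (rule coeff_upper) blast
  have bound: "?A s z \<le> (2 * D + B) powr \<gamma>" if "s \<in> {0..R}" "z \<le> D" for s z
    using B(2)[of 1 1 s z D] that D by auto
  have adm: "admissible R ?A" by (intro admissible_coeff) auto
  \<comment> \<open>With the delay \<open>R / (k + 1)\<close>, exactly \<open>k + 1\<close>
    iterations cover \<open>{0..R}\<close>.\<close>
  define \<epsilon> where "\<epsilon> k = R / real (Suc k)" for k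
  have \<epsilon>: "0 < \<epsilon> k" "R \<le> real (Suc k) * \<epsilon> k" for k using assms by (auto simp: \<epsilon>_def)
  define F where "F k d = iterate ?A (\<epsilon> k) (Suc k) d" for k d
  have sol: "delayed_solution ?A (\<epsilon> k) d R (F k d)" for k d
    unfolding F_def by (rule iterate_solution[OF adm \<epsilon>])
  txt \<open>For \<open>d = D\<close> only undelayed solutions are known to be negative at \<open>R\<close>. Hence the alternative
    \<open>F k d R = 0\<close> or \<open>d = D\<close> is written as a product, which survives the limit.\<close>
  have "\<exists>d\<in>{d0..D}. 0 \<le> F k d R \<and> F k d R * (D - d) = 0" for k
  proof (cases "0 \<le> F k D R")
    case True
    then show ?thesis using d0 D by (intro bexI[of _ D]) auto
  next
    case False
    have "continuous_on {d0..D} (\<lambda>d. F k d R)"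
      unfolding continuous_on_sequentially comp_def
    proof (intro allI ballI impI)
      fix x d assume "d \<in> {d0..D}" "(\<forall>n. x n \<in> {d0..D}) \<and> x \<longlonglongrightarrow> d"
      then show "(\<lambda>n. F k (x n) R) \<longlonglongrightarrow> F k d R"
        unfolding F_def using D assms \<epsilon>(1)[of k] bound
        by (intro iterate_tendsto[OF adm, where M = D and B = "(2 * D + B) powr \<gamma>"]) auto
    qed
    moreover have "0 \<le> F k d0 R" using d0(3)[OF _ sol] \<epsilon>(1)[of k] by (simp add: less_imp_le)
    ultimately obtain d where "d0 \<le> d" "d \<le> D" "F k d R = 0"
      using IVT2'[of "\<lambda>d. F k d R" D 0 d0] False d0 D by auto
    then show ?thesis by (intro bexI[of _ d]) auto
  qed
  then obtain \<eta> where \<eta>: "\<And>k. \<eta> k \<in> {d0..D}" "\<And>k. 0 \<le> F k (\<eta> k) R" "\<And>k. F k (\<eta> k) R * (D - \<eta> k) = 0"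
    by metis
  obtain d r where d: "d \<in> {d0..D}" and r: "strict_mono (r :: nat \<Rightarrow> nat)" and lim: "(\<eta> \<circ> r) \<longlonglongrightarrow> d"
    using compact_Icc[of d0 D] \<eta>(1) unfolding compact_eq_seq_compact_metric seq_compact_def by metis
  have eps0: "(\<lambda>k. \<epsilon> (r k)) \<longlonglongrightarrow> 0"
  proof -
    have "\<epsilon> \<longlonglongrightarrow> 0"
      unfolding \<epsilon>_def by (intro tendsto_divide_0[OF tendsto_const] filterlim_at_top_imp_at_infinity
        filterlim_compose[OF filterlim_real_sequentially filterlim_Suc])
    from filterlim_compose[OF this filterlim_subseq[OF r]] show ?thesis .
  qed
  obtain v h where v: "delayed_solution ?A 0 d R v" and h: "strict_mono (h :: nat \<Rightarrow> nat)"
    and conv: "\<And>s. s \<in> {0..R} \<Longrightarrow> (\<lambda>k. F (r (h k)) (\<eta> (r (h k))) s) \<longlonglongrightarrow> v s"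
  proof (rule solution_compactness[of R "\<lambda>_. ?A" "\<lambda>k. \<epsilon> (r k)" "\<lambda>k. \<eta> (r k)" "\<lambda>k. F (r k) (\<eta> (r k))" d D
        "(2 * D + B) powr \<gamma>" ?A])
    show "(\<lambda>k. ?A s (x k)) \<longlonglongrightarrow> ?A s y" if "s \<in> {0..R}" "x \<longlonglongrightarrow> y" for s x y
      using admissible_tendsto[OF adm that] .
    show "(\<lambda>k. \<eta> (r k)) \<longlonglongrightarrow> d" using lim by (simp add: comp_def)
  qed (use adm sol \<epsilon>(1) eps0 \<eta>(1) D assms bound in \<open>auto simp: less_imp_le\<close>)
  have convR: "(\<lambda>k. F (r (h k)) (\<eta> (r (h k))) R) \<longlonglongrightarrow> v R" using conv assms by simp
  have "(\<lambda>k. \<eta> (r (h k))) \<longlonglongrightarrow> d"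
    using filterlim_compose[OF lim filterlim_subseq[OF h]] by (simp add: comp_def)
  then have "(\<lambda>k. F (r (h k)) (\<eta> (r (h k))) R * (D - \<eta> (r (h k)))) \<longlonglongrightarrow> v R * (D - d)"
    by (intro tendsto_intros convR)
  then have "(\<lambda>k. 0) \<longlonglongrightarrow> v R * (D - d)" by (simp only: \<eta>(3))
  then have "v R * (D - d) = 0" by (simp only: LIMSEQ_const_iff)
  \<comment> \<open>If \<open>d\<close> were \<open>D\<close>, then \<open>v\<close> would be an
    undelayed solution that is nonnegative at \<open>R\<close>, against the choice of
    \<open>D\<close>; so the other factor vanishes.\<close>
  moreover have "0 \<le> v R" by (rule LIMSEQ_le_const[OF convR]) (use \<eta>(2) in auto)
  then have "d \<noteq> D" using D(2) v by force
  ultimately have "v R = 0" by simp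
  then show thesis using that[of d v] v d d0(1) by auto
qed

text \<open>Undoing the power in \<open>slope\<close> identifies the flux of \<open>v\<close> with
  \<open>- mass v\<close>, whose derivative is minus the source; positivity turns
  \<open>max 0 (v r)\<close> into \<open>v r\<close>.\<close>

lemma radial_solution_of_integral_solution:
  fixes N :: nat and \<alpha> \<beta> :: real
  assumes "0 < d" "0 < R" and v: "delayed_solution (coeff 1 1) 0 d R v" and "v R = 0"
    and theta: "\<theta> = real N + \<alpha> - 1" and sigma: "\<sigma> = real N + \<beta> - 1"
  shows "positive_radial_solution N R m \<alpha> \<beta> \<gamma> p a g v"
proof -
  let ?A = "coeff 1 1"
  define dv where "dv r = - slope ?A v r" for r
  have adm: "admissible R ?A" by (intro admissible_coeff) auto
  have cont: "continuous_on {0..R} v" by (rule solution_continuous[OF v])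
  have pos: "0 < v r" if "r \<in> {0..<R}" for r
    by (rule solution_pos[OF adm v]) (use that assms in \<open>auto intro: coeff_pos\<close>)
  have flux: "flux N m \<alpha> \<gamma> a g v dv r = - mass v r" if r: "r \<in> {0<..<R}" for r
  proof -
    have "0 < mass v r" by (rule solution_mass_pos[OF v]) (use r assms in auto)
    have A: "?A r (v r) = (a r + g (v r)) powr \<gamma>" "0 < ?A r (v r)"
      using pos[of r] r coeff_pos[of 1 1 r "v r"] by (auto simp: coeff_def)
    have X: "0 < ?A r (v r) * (r powr - \<theta> * mass v r)" using A \<open>0 < mass v r\<close> r by simp
    then have s: "0 < slope ?A v r" unfolding slope_def by (subst powr_gt_zero) linarith
    have "slope ?A v r powr (m - 2) * slope ?A v r = slope ?A v r powr (m - 2) * slope ?A v r powr 1"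
      using s by simp
    also have "\<dots> = slope ?A v r powr (m - 1)" unfolding powr_add[symmetric] by (simp only: diff_add_eq) simp
    also have "\<dots> = ?A r (v r) * (r powr - \<theta> * mass v r)"
      using X m_gt_1 unfolding slope_def powr_powr by simp
    finally have "\<bar>dv r\<bar> powr (m - 2) * dv r = - (?A r (v r) * (r powr - \<theta> * mass v r))"
      using s by (simp add: dv_def)
    then have "flux N m \<alpha> \<gamma> a g v dv r = r powr \<theta> * - (?A r (v r) * (r powr - \<theta> * mass v r)) / ?A r (v r)"
      unfolding flux_def A(1)[symmetric] theta by simp
    also have "\<dots> = - (r powr \<theta> * r powr - \<theta>) * mass v r" using A(2) by simp
    also have "r powr \<theta> * r powr - \<theta> = 1" using r by (simp flip: powr_add)
    finally show ?thesis by simp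
  qed
  define dw where "dw r = - (r powr \<sigma> * max 0 (v r) powr p)" for r
  have dw: "(flux N m \<alpha> \<gamma> a g v dv has_real_derivative dw r) (at r)" if r: "r \<in> {0<..<R}" for r
  proof -
    have "((\<lambda>r. - mass v r) has_real_derivative dw r) (at r)"
      unfolding dw_def by (intro DERIV_minus mass_has_derivative[OF cont]) (use r in auto)
    then show ?thesis
      by (rule has_field_derivative_transform_within_open[of _ _ _ "{0<..<R}"]) (use r flux in auto)
  qed
  have "continuous_on {0<..<R} dw"
    unfolding dw_def
    by (intro continuous_on_minus continuous_on_mult continuous_on_pos_powr continuous_on_powr continuous_on_id
        continuous_on_const continuous_on_subset[OF cont]) auto
  moreover have "- dw r = r powr (real N + \<beta> - 1) * v r powr p" if "r \<in> {0<..<R}" for r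
    using pos[of r] that by (simp add: dw_def sigma)
  moreover have "continuous_on {0..<R} dv"
    unfolding dv_def
    by (intro continuous_on_minus continuous_on_subset[OF admissible_slope[OF adm cont]]) (use assms in auto)
  moreover have "(v has_real_derivative dv r) (at r within {0..<R})" if "r \<in> {0..<R}" for r
    unfolding dv_def
    by (rule DERIV_subset[OF solution_has_derivative_within[OF adm v]]) (use that in auto)
  moreover have "dv 0 = 0" by (simp add: dv_def)
  ultimately show ?thesis
    unfolding positive_radial_solution_def using pos cont \<open>v R = 0\<close> dw by blast
qed

end

theorem theorem1p1:
  fixes N :: nat and R m p alpha beta gamma c1 c2 :: real
    and a g :: "real \<Rightarrow> real"
  assumes "N \<ge> 1" and "R > 0" and "m > 1" and "real N > m" and "p > 1"
    and "0 < gamma" and "gamma < m - 1"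
    and H0: "real N + alpha - m > 0" "beta - alpha + 1 > 0"
    and H1: "m - 1 < p"
      "p < (m * (m - 1) * (real N + beta) - gamma * (m * (real N + beta + 1) - real N - alpha))
             / ((m - 1) * (real N + alpha - m)) - 1"
      "gamma < m * (m - 1) * (beta - alpha + m) / (m * (real N + beta + 1) - real N - alpha)"
    and H2: "continuous_on {0..} g" "\<forall>v\<in>{0..}. g v \<ge> 0" "mono_on {0..} g"
      "((\<lambda>v. g v / v) \<longlongrightarrow> 1) at_top"
    and H3: "continuous_on {0..} a" "\<forall>t\<in>{0..}. a t > 0"
      "0 < c1" "c1 \<le> c2" "\<forall>t\<in>{0..}. c1 \<le> a t \<and> a t \<le> c2"
  shows "\<exists>v. positive_radial_solution N R m alpha beta gamma p a g v"
proof -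
  \<comment> \<open>In terms of the locale, \<open>Y = \<theta> + 1 - m\<close>,
    \<open>Z = \<sigma> + 1\<close> and \<open>\<eta> = (m - 1) * \<delta>\<close> with
    \<open>\<delta> = 1 - gamma / (m - 1)\<close>.\<close>
  define Y where "Y = real N + alpha - m"
  define Z where "Z = real N + beta"
  define \<eta> where "\<eta> = m - 1 - gamma"
  have pos: "0 < Y" "0 < \<eta>" "0 < m - 1" using assms by (auto simp: Y_def \<eta>_def)
  \<comment> \<open>The upper bound on \<open>p\<close>, multiplied by \<open>(m - 1) * Y\<close>.
    Moving \<open>gamma * Y\<close> to the left and dividing by \<eta> gives subcriticality for
    \<open>q = p / \<delta>\<close>.\<close>
  have "(p + 1) * ((m - 1) * Y) < m * (m - 1) * Z - gamma * (m * (Z + 1) - real N - alpha)"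
    using H1(2) pos by (simp add: Y_def Z_def less_diff_eq pos_less_divide_eq)
  also have "\<dots> = \<eta> * (m * Z) + gamma * Y" by (simp add: \<eta>_def Y_def algebra_simps)
  finally have "(p * (m - 1) + \<eta>) * Y < \<eta> * (m * Z)" by (simp add: \<eta>_def algebra_simps)
  moreover have "(p / (1 - gamma / (m - 1)) + 1) * Y = (p * (m - 1) + \<eta>) * Y / \<eta>"
  proof -
    have "1 - gamma / (m - 1) = \<eta> / (m - 1)" using pos by (simp add: \<eta>_def diff_divide_distrib)
    then have "p / (1 - gamma / (m - 1)) + 1 = (p * (m - 1) + \<eta>) / \<eta>"
      using pos by (simp add: add_divide_distrib)
    then show ?thesis by simp
  qed
  ultimately have "(p / (1 - gamma / (m - 1)) + 1) * Y < m * Z"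
    using pos by (simp add: pos_divide_less_eq mult.commute)
  moreover have "real N + alpha - 1 + 1 - m = Y" "real N + beta - 1 + 1 = Z" by (simp_all add: Y_def Z_def)
  ultimately interpret quasilinear m "real N + alpha - 1" "real N + beta - 1" p gamma c1 c2 a g
    by unfold_locales (use assms in auto)
  from boundary_solution[OF \<open>R > 0\<close>] obtain d v
    where "0 < d" "delayed_solution (coeff 1 1) 0 d R v" "v R = 0" by blast
  then show ?thesis using radial_solution_of_integral_solution \<open>R > 0\<close> by blast
qed

end
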